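(* For every $\varepsilon>0$ there is a constant $C_\varepsilon>0$ such that the following holds. Let $p\equiv-1$ mod $12$ be prime, fix a Farey symbol of level $p$, and consider the associated $\frac{p+1}{6}$ matrices $$\begin{pmatrix} a_{i^*+1}b_{i+1}+a_{i^*}b_i & -a_ia_{i^*}-a_{i+1}a_{i^*+1} \\ b_ib_{i^*}+b_{i+1}b_{i^*+1} & -a_{i+1}b_{i^*+1}-a_ib_{i^*} \end{pmatrix},\qquad i<i^*\text{ a pair}.\tag{$\ast$}$$ Let $K$ be a real quadratic field of discriminant $d_K$ and (wide) class number one such that $p$ splits in $K$ with $p\mathcal{O}_K=\mathfrak{p}_1\mathfrak{p}_2$ and $\mathfrak{p}_1$ does not have a generator of positive norm. Let $(u,v)$ be the positive half-integer solution to $u^2-d_Kv^2=1$ with $v$ minimal among all such, and let $a,b,c\in\mathbb{Z}$ satisfy $b^2-4ac=d_K$ and $p\mid a$. If $d_K\geq C_\varepsilon p^{24+\varepsilon}$, then the matrix $\begin{pmatrix} u+bv & 2cv \\ -2av & u-bv \end{pmatrix}\in\Gamma_0(p)$ is not contained in the subgroup of $\Gamma_0(p)$ generated by the matrices $(\ast)$.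
   Context: $\Gamma_0(p)$ denotes the image in $\mathrm{PSL}_2(\mathbb{Z})$ of the matrices with lower left entry divisible by $p$; matrices are considered as elements of $\mathrm{PSL}_2(\mathbb{Z})$. "Half-integer" means an element of $\frac12\mathbb{Z}$ (integers allowed). For $p\equiv-1$ mod $12$ put $n=\frac{p+1}{3}$. A Farey symbol of level $p$ is a sequence of reduced fractions $$\frac01=\frac{a_0}{b_0}<\frac{a_1}{b_1}<\dots<\frac{a_{n-1}}{b_{n-1}}<\frac{a_n}{b_n}=\frac11$$ with $a_{i+1}b_i-a_ib_{i+1}=1$ for all $0\leq i<n$, together with a pairing (fixed-point free involution) $i\leftrightarrow i^*$ of $\{0,\dots,n-1\}$ such that $b_ib_{i^*}+b_{i+1}b_{i^*+1}\equiv0$ mod $p$ for all $i$. Such symbols exist. (It is known that $\Gamma_0(p)$ is then freely generated by $\begin{pmatrix} 1 & 1 \\ 0 & 1 \end{pmatrix}$ together with the $\frac{p+1}{6}$ matrices $(\ast)$.) *)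

theory Defs
  imports
    "HOL-Analysis.Determinants"
    "HOL-Algebra.Ideal_Product"
    "HOL-Algebra.Subrings"
    "HOL-Algebra.Generated_Groups"
    "HOL-Algebra.Algebraic_Closure_Type"
    "HOL-Number_Theory.Cong"
begin

subsection \<open>Real quadratic fields\<close>

abbreviation real_ring :: "real ring" where
  "real_ring \<equiv> ring_of_type_algebra"

text \<open>A real quadratic field is taken with one of its two embeddings into the reals.  A subspace
  of infinite dimension has \<open>dim\<close> equal to 0, so \<open>dim K = 2\<close> really means degree 2.\<close>

definition real_quadratic_field :: "real set \<Rightarrow> bool" where
  "real_quadratic_field K \<longleftrightarrow>
     subfield K real_ring \<and> vector_space.dim (\<lambda>(q::rat) (x::real). of_rat q * x) K = 2"

definition ring_of_integers :: "real set \<Rightarrow> real ring" where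
  "ring_of_integers K = real_ring\<lparr>carrier := {x \<in> K. algebraic_int x}\<rparr>"

text \<open>All complex embeddings of a real quadratic field are real, so the sum and the product
  over the real embeddings are the trace and the norm of \<open>K\<close> over the rationals.
  Extensionality makes every embedding be counted once.\<close>

definition real_embeddings :: "real set \<Rightarrow> (real \<Rightarrow> real) set" where
  "real_embeddings K = ring_hom (real_ring\<lparr>carrier := K\<rparr>) real_ring \<inter> extensional K"

definition field_trace :: "real set \<Rightarrow> real \<Rightarrow> real" where
  "field_trace K x = (\<Sum>\<sigma>\<in>real_embeddings K. \<sigma> x)"

definition field_norm :: "real set \<Rightarrow> real \<Rightarrow> real" where
  "field_norm K x = (\<Prod>\<sigma>\<in>real_embeddings K. \<sigma> x)"

definition integral_basis :: "real set \<Rightarrow> real \<Rightarrow> real \<Rightarrow> bool" where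
  "integral_basis K w1 w2 \<longleftrightarrow>
     w1 \<in> carrier (ring_of_integers K) \<and> w2 \<in> carrier (ring_of_integers K) \<and>
     (\<forall>x\<in>carrier (ring_of_integers K).
        \<exists>!(m, n). x = of_int m * w1 + of_int n * w2)"

definition field_discriminant :: "real set \<Rightarrow> int" where
  "field_discriminant K =
     (THE d. \<exists>w1 w2. integral_basis K w1 w2 \<and>
        of_int d = field_trace K (w1 * w1) * field_trace K (w2 * w2)
                   - field_trace K (w1 * w2) * field_trace K (w2 * w1))"

text \<open>Wide ideal classes: no sign condition on the norms of the scaling factors.  Every class of
  fractional ideals contains an integral ideal, so integral ideals suffice.\<close>

definition nonzero_ideals :: "real set \<Rightarrow> real set set" where
  "nonzero_ideals K = {I. ideal I (ring_of_integers K) \<and> I \<noteq> {0}}"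

definition ideal_equiv :: "real set \<Rightarrow> (real set \<times> real set) set" where
  "ideal_equiv K =
     {(I, J). I \<in> nonzero_ideals K \<and> J \<in> nonzero_ideals K \<and>
        (\<exists>x\<in>carrier (ring_of_integers K) - {0}. \<exists>y\<in>carrier (ring_of_integers K) - {0}.
           (\<lambda>z. x * z) ` I = (\<lambda>z. y * z) ` J)}"

definition class_number :: "real set \<Rightarrow> nat" where
  "class_number K = card (nonzero_ideals K // ideal_equiv K)"

definition splits_as :: "real set \<Rightarrow> nat \<Rightarrow> real set \<Rightarrow> real set \<Rightarrow> bool" where
  "splits_as K p P1 P2 \<longleftrightarrow>
     primeideal P1 (ring_of_integers K) \<and> primeideal P2 (ring_of_integers K) \<and> P1 \<noteq> P2 \<and>
     cgenideal (ring_of_integers K) (of_nat p) = ideal_prod (ring_of_integers K) P1 P2"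


subsection \<open>The modular group\<close>

abbreviation mat2 :: "'a::zero \<Rightarrow> 'a \<Rightarrow> 'a \<Rightarrow> 'a \<Rightarrow> 'a^2^2" where
  "mat2 x y z w \<equiv> vector [vector [x, y], vector [z, w]]"

definition SL2Z :: "(int^2^2) monoid" where
  "SL2Z = \<lparr>carrier = {A. det A = 1}, monoid.mult = (**), one = mat 1\<rparr>"

definition PSL2Z :: "(int^2^2) set monoid" where
  "PSL2Z = SL2Z Mod {mat 1, - mat 1}"

definition to_PSL2Z :: "int^2^2 \<Rightarrow> (int^2^2) set" where
  "to_PSL2Z A = {mat 1, - mat 1} #>\<^bsub>SL2Z\<^esub> A"

definition Gamma0 :: "nat \<Rightarrow> (int^2^2) set monoid" where
  "Gamma0 p = PSL2Z\<lparr>carrier := to_PSL2Z ` {A \<in> carrier SL2Z. int p dvd A $ 2 $ 1}\<rparr>"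


subsection \<open>Farey symbols\<close>

text \<open>The fractions are \<open>a i / b i\<close> with \<open>i \<le> n\<close> and \<open>s\<close> is the pairing; values at larger indices
  play no role.  The division by 3 is exact for \<open>p \<equiv> -1\<close> modulo 12.\<close>

definition farey_symbol ::
  "nat \<Rightarrow> (nat \<Rightarrow> int) \<Rightarrow> (nat \<Rightarrow> int) \<Rightarrow> (nat \<Rightarrow> nat) \<Rightarrow> bool" where
  "farey_symbol p a b s \<longleftrightarrow>
     (let n = (p + 1) div 3 in
        (\<forall>i\<le>n. b i > 0 \<and> coprime (a i) (b i)) \<and>
        a 0 = 0 \<and> b 0 = 1 \<and> a n = 1 \<and> b n = 1 \<and>
        (\<forall>i<n. rat_of_int (a i) / rat_of_int (b i)
                 < rat_of_int (a (i + 1)) / rat_of_int (b (i + 1))) \<and>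
        (\<forall>i<n. a (i + 1) * b i - a i * b (i + 1) = 1) \<and>
        (\<forall>i<n. s i < n \<and> s i \<noteq> i \<and> s (s i) = i) \<and>
        (\<forall>i<n. [b i * b (s i) + b (i + 1) * b (s i + 1) = 0] (mod int p)))"

definition farey_matrix ::
  "(nat \<Rightarrow> int) \<Rightarrow> (nat \<Rightarrow> int) \<Rightarrow> nat \<Rightarrow> nat \<Rightarrow> int^2^2" where
  "farey_matrix a b i j =
     mat2 (a (j + 1) * b (i + 1) + a j * b i) (- a i * a j - a (i + 1) * a (j + 1))
          (b i * b j + b (i + 1) * b (j + 1)) (- a (i + 1) * b (j + 1) - a i * b j)"

definition farey_matrices ::
  "nat \<Rightarrow> (nat \<Rightarrow> int) \<Rightarrow> (nat \<Rightarrow> int) \<Rightarrow> (nat \<Rightarrow> nat) \<Rightarrow> (int^2^2) set set" where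
  "farey_matrices p a b s =
     {to_PSL2Z (farey_matrix a b i (s i)) | i. i < (p + 1) div 3 \<and> i < s i}"


subsection \<open>The Pell equation\<close>

definition half_integer :: "rat \<Rightarrow> bool" where
  "half_integer x \<longleftrightarrow> 2 * x \<in> \<int>"

definition positive_pell_solution :: "int \<Rightarrow> rat \<Rightarrow> rat \<Rightarrow> bool" where
  "positive_pell_solution d u v \<longleftrightarrow>
     half_integer u \<and> half_integer v \<and> u > 0 \<and> v > 0 \<and> u\<^sup>2 - of_int d * v\<^sup>2 = 1"

definition minimal_pell_solution :: "int \<Rightarrow> rat \<Rightarrow> rat \<Rightarrow> bool" where
  "minimal_pell_solution d u v \<longleftrightarrow>
     positive_pell_solution d u v \<and> (\<forall>u' v'. positive_pell_solution d u' v' \<longrightarrow> v \<le> v')"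

end

theory Submission
  imports Defs
begin

text \<open>Write \<open>Q\<close> for the form \<open>(a, b, c)\<close> of discriminant \<open>D\<close>; the axis of the matrix in question
  joins the two roots of \<open>Q\<close>.  The side pairings of the Farey symbol play ping-pong on the Farey
  intervals, so the axis of every nontrivial element of the group they generate has both ends inside
  \<open>(0, 1)\<close>.  A counting argument on the projective line over the field with \<open>p\<close> elements shows
  that \<open>p\<close> divides none of the \<open>b i\<close>; hence every cusp whose denominator is divisible by \<open>p\<close> can be
  moved by the group out of \<open>(0, 1)\<close>, and the axis crosses no \<open>\<Gamma>\<^sub>0(p)\<close>-translate of the geodesic
  from \<open>0\<close> to infinity.

  On the other hand, class number one makes the ideal attached to \<open>Q\<close> principal, so \<open>Q\<close> represents
  \<open>1\<close> or \<open>- 1\<close>.  Multiplying the representing element by \<open>(t + \<surd>D) / 2\<close> with \<open>t\<^sup>2 < D\<close> and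
  \<open>t \<equiv> - b\<close> modulo \<open>2 p\<close>, which is possible because \<open>D > p\<^sup>2\<close>, changes the sign of the value and
  produces such a translate that does cross the axis.\<close>

no_notation fps_nth (infixl \<open>$\<close> 75)

subsection \<open>Quadratic fields inside the reals\<close>

lemma real_ring_simps [simp]:
  "carrier (real_ring :: real ring) = UNIV" "x \<otimes>\<^bsub>real_ring\<^esub> y = x * (y :: real)"
  "x \<oplus>\<^bsub>real_ring\<^esub> y = x + (y :: real)" "\<one>\<^bsub>real_ring\<^esub> = (1 :: real)" "\<zero>\<^bsub>real_ring\<^esub> = (0 :: real)"
  by (simp_all add: ring_of_type_algebra_def)

lemma ring_of_integers_simps [simp]:
  "carrier (ring_of_integers K) = {x \<in> K. algebraic_int x}" "x \<otimes>\<^bsub>ring_of_integers K\<^esub> y = x * y"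
  "x \<oplus>\<^bsub>ring_of_integers K\<^esub> y = x + y" "\<one>\<^bsub>ring_of_integers K\<^esub> = 1" "\<zero>\<^bsub>ring_of_integers K\<^esub> = 0"
  by (simp_all add: ring_of_integers_def ring_of_type_algebra_def)

lemma subfield_real_closed:
  assumes "subfield K (real_ring :: real ring)"
  shows "1 \<in> K" "0 \<in> K" "x \<in> K \<Longrightarrow> y \<in> K \<Longrightarrow> x + y \<in> K" "x \<in> K \<Longrightarrow> y \<in> K \<Longrightarrow> x * y \<in> K"
    "x \<in> K \<Longrightarrow> - x \<in> K" "x \<in> K \<Longrightarrow> y \<in> K \<Longrightarrow> x / y \<in> K" "of_rat q \<in> K"
proof -
  interpret R: field "real_ring :: real ring" by (rule field_from_type_algebra)
  have sr: "subring K (real_ring :: real ring)" using subfieldE(1)[OF assms] .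
  note E = subringE[OF sr, simplified]
  show one: "1 \<in> K" and zero: "0 \<in> K" and mult: "\<And>x y. x \<in> K \<Longrightarrow> y \<in> K \<Longrightarrow> x * y \<in> K"
    and add: "\<And>x y. x \<in> K \<Longrightarrow> y \<in> K \<Longrightarrow> x + y \<in> K" using E by auto
  have um: "\<ominus>\<^bsub>real_ring\<^esub> x = - x" for x :: real
    by (rule R.minus_equality) auto
  show minus: "\<And>x. x \<in> K \<Longrightarrow> - x \<in> K" using E(5) by (simp add: um)
  have inv: "inverse y \<in> K" if "y \<in> K" for y
  proof (cases "y = 0")
    case False
    then have "y \<in> K - {\<zero>\<^bsub>real_ring\<^esub>}" using that by simp
    from R.subfield_m_inv[OF assms this] show ?thesis by (auto simp: inverse_unique)
  qed (simp add: zero)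
  then show div: "\<And>x y. x \<in> K \<Longrightarrow> y \<in> K \<Longrightarrow> x / y \<in> K" by (simp add: mult field_class.field_divide_inverse)
  have nat: "of_nat n \<in> K" for n by (induction n) (auto simp: one zero add)
  have int: "of_int i \<in> K" for i
    using nat[of "nat i"] minus[OF nat[of "nat (- i)"]] by (cases "0 \<le> i") auto
  show "of_rat q \<in> K" by (cases q) (simp add: of_rat_rat div int)
qed

lemma rat_fraction:
  fixes q :: rat
  obtains u w :: int where "0 < w" "q = of_int u / of_int w"
  by (cases q) (auto simp: Fract_of_int_quotient intro: that)

lemma real_quadratic_field_sqrt:
  assumes "real_quadratic_field K"
  obtains m :: nat where "squarefree m" "sqrt m \<notin> \<rat>" "K = {of_rat q + of_rat r * sqrt m | q r. True}"
proof -
  interpret Q: vector_space "\<lambda>(q::rat) (x::real). of_rat q * x"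
    by unfold_locales (auto simp: algebra_simps of_rat_add of_rat_mult)
  have sf: "subfield K (real_ring :: real ring)" and dim: "Q.dim K = 2"
    using assms by (auto simp: real_quadratic_field_def)
  note closed = subfield_real_closed[OF sf]
  obtain B where B: "B \<subseteq> K" "Q.independent B" "K \<subseteq> Q.span B" "card B = 2"
    by (rule Q.basis_exists[of K]) (simp add: dim)
  then obtain b1 b2 where b: "B = {b1, b2}" "b1 \<noteq> b2" by (meson card_2_iff)
  have b2: "b2 \<noteq> 0" using B b Q.dependent_zero[of B] by auto
  have b1: "b1 \<notin> Q.span {b2}" using B b by (simp add: Q.independent_insert)
  define y where "y = b1 / b2"
  have y: "y \<in> K" using B b closed(6) by (auto simp: y_def)
  have irr: "y \<noteq> of_rat q" for q
  proof
    assume "y = of_rat q"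
    then have "b1 = of_rat q * b2" using b2 by (simp add: y_def field_simps)
    then show False using b1 by (auto simp: Q.span_singleton)
  qed
  have rep: "\<exists>q r. x = of_rat q * y + of_rat r" if "x \<in> K" for x
  proof -
    have "x * b2 \<in> Q.span {b1, b2}" using B(1,3) b(1) closed(4)[OF that, of b2] by blast
    then obtain q where "x * b2 - of_rat q * b1 \<in> Q.span {b2}" by (metis Q.span_breakdown_eq)
    then obtain r where "x * b2 - of_rat q * b1 = of_rat r * b2" by (auto simp: Q.span_singleton)
    then have "x * b2 = (of_rat q * y + of_rat r) * b2" using b2 by (simp add: y_def algebra_simps)
    then have "x = of_rat q * y + of_rat r" using b2 by simp
    then show ?thesis by blast
  qed
  obtain \<alpha> \<beta> where ab: "y * y = of_rat \<alpha> * y + of_rat \<beta>" using rep closed(4)[OF y y] by blast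
  define z where "z = y - of_rat (\<alpha> / 2)"
  have z: "z * z = of_rat (\<beta> + \<alpha> * \<alpha> / 4)"
    using ab by (simp add: z_def of_rat_add of_rat_mult of_rat_divide algebra_simps)
  obtain u w :: int where uw: "w > 0" "\<beta> + \<alpha> * \<alpha> / 4 = of_int u / of_int w"
    by (rule rat_fraction)
  have "(of_int w * z) * (of_int w * z) = of_int w * of_int w * (z * z)" by (simp add: algebra_simps)
  also have "\<dots> = of_int (u * w)" unfolding z uw(2) using uw(1) by (simp add: of_rat_divide)
  finally have wz: "(of_int w * z)\<^sup>2 = of_int (u * w)" by (simp add: power2_eq_square)
  then have "0 \<le> (of_int (u * w) :: real)" by (metis zero_le_power2)
  then have uw0: "0 \<le> u * w" by linarith
  define N where "N = nat (u * w)"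
  define m where "m = squarefree_part N"
  define k where "k = square_part N"
  have "of_int (u * w) = real N" using uw0 by (simp add: N_def)
  also have "\<dots> = real m * (real k)\<^sup>2"
    using squarefree_decompose[of N] by (metis m_def k_def of_nat_mult of_nat_power)
  finally have mk: "\<bar>of_int w * z\<bar> = sqrt m * k"
    using real_sqrt_abs[of "of_int w * z"] unfolding wz by (simp only: real_sqrt_mult real_sqrt_abs abs_of_nat)
  obtain \<sigma> :: rat where \<sigma>: "\<bar>\<sigma>\<bar> = 1" "of_int w * z = of_rat \<sigma> * (sqrt m * k)"
  proof (cases "0 \<le> of_int w * z")
    case True
    then show ?thesis using that[of 1] mk by simp
  next
    case False
    then show ?thesis using that[of "-1"] mk by (simp add: of_rat_minus)
  qed
  define c where "c = \<sigma> * of_nat k / of_int w"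
  have zc: "z = of_rat c * sqrt m"
    using \<sigma>(2) uw(1) by (simp add: c_def of_rat_mult of_rat_divide field_simps)
  have zirr: "z \<noteq> of_rat q" for q
    using irr[of "q + \<alpha> / 2"] unfolding z_def of_rat_add by linarith
  have yc: "y = of_rat (\<alpha> / 2) + of_rat c * sqrt m" using zc unfolding z_def by linarith
  have c0: "c \<noteq> 0" using zirr[of 0] unfolding zc by auto
  have sm_irr: "sqrt m \<notin> \<rat>"
  proof
    assume "sqrt m \<in> \<rat>"
    then obtain q where "sqrt m = of_rat q" by (rule Rats_cases)
    then show False using zirr[of "c * q"] unfolding zc by (simp add: of_rat_mult)
  qed
  have sqf: "squarefree m" by (simp add: m_def squarefree_squarefree_part)
  have "K = {of_rat q + of_rat r * sqrt m | q r. True}"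
  proof (intro equalityI subsetI)
    fix x assume "x \<in> K"
    then obtain q r where "x = of_rat q * y + of_rat r" using rep by blast
    also have "\<dots> = of_rat (r + q * (\<alpha> / 2)) + of_rat (q * c) * sqrt m"
      unfolding yc of_rat_add of_rat_mult by (simp only: algebra_simps)
    finally show "x \<in> {of_rat q + of_rat r * sqrt m | q r. True}"
      by (intro CollectI exI conjI TrueI)
  next
    fix x assume "x \<in> {of_rat q + of_rat r * sqrt m | q r. True}"
    then obtain q r where x: "x = of_rat q + of_rat r * sqrt m" by blast
    have "(y + of_rat (- (\<alpha> / 2))) / of_rat c \<in> K"
      by (rule closed(6)[OF closed(3)[OF y closed(7)] closed(7)])
    moreover have "(y + of_rat (- (\<alpha> / 2))) / of_rat c = sqrt m"
      unfolding yc using c0 by (simp add: of_rat_minus)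
    ultimately have sm: "sqrt m \<in> K" by simp
    show "x \<in> K" unfolding x by (rule closed(3)[OF closed(7) closed(4)[OF closed(7) sm]])
  qed
  then show ?thesis by (rule that[OF sqf sm_irr])
qed

lemma bounded_denominator_imp_int:
  fixes t :: "'a::field_char_0"
  assumes "t \<in> \<rat>" "M \<noteq> 0" "\<And>k. of_int M * t ^ k \<in> \<int>"
  shows "t \<in> \<int>"
proof -
  obtain u w :: int where uw: "w > 0" "Rings.coprime u w" "t = of_int u / of_int w"
    using Rats_cases'[OF assms(1)] by metis
  have dvd: "w ^ k dvd M" for k
  proof -
    obtain A where "of_int M * t ^ k = of_int A" using assms(3)[of k] by (auto elim: Ints_cases)
    then have "of_int (M * u ^ k) = (of_int (A * w ^ k) :: 'a)"
      using uw by (simp add: power_divide field_simps)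
    then have "M * u ^ k = A * w ^ k" by (simp only: of_int_eq_iff)
    then have "w ^ k dvd M * u ^ k" by simp
    moreover have "Rings.coprime (w ^ k) (u ^ k)" using uw by (simp add: coprime_commute)
    ultimately show ?thesis by (simp add: coprime_dvd_mult_left_iff)
  qed
  have "w = 1"
  proof (rule ccontr)
    assume "w \<noteq> 1"
    then have "2 ^ nat \<bar>M\<bar> \<le> w ^ nat \<bar>M\<bar>" using uw by (intro power_mono) auto
    moreover have "w ^ nat \<bar>M\<bar> \<le> \<bar>M\<bar>" 
      using dvd_imp_le_int[OF assms(2) dvd[of "nat \<bar>M\<bar>"]] by linarith
    moreover have "int (nat \<bar>M\<bar>) < 2 ^ nat \<bar>M\<bar>" by (metis of_nat_less_two_power)
    ultimately show False by simp
  qed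
  then show ?thesis using uw by simp
qed

locale irrational_sqrt =
  fixes D :: int and s :: real
  assumes s_sq: "s * s = of_int D" and s_irr: "s \<notin> \<rat>"
begin

definition L :: "real set" where "L = {of_int i + of_int j * s | i j. True}"

lemma coords_unique:
  assumes "of_rat q + of_rat r * s = of_rat q' + of_rat r' * s"
  shows "q = q' \<and> r = r'"
proof -
  have "r = r'"
  proof (rule ccontr)
    assume "r \<noteq> r'"
    then have "s = of_rat ((q' - q) / (r - r'))"
      using assms by (simp add: of_rat_divide of_rat_diff field_simps)
    then show False using s_irr by auto
  qed
  then show ?thesis using assms by simp
qed

lemma int_coords_unique:
  assumes "of_int i + of_int j * s = of_int i' + of_int j' * s"
  shows "i = i' \<and> j = j'"
  using coords_unique[of "of_int i" "of_int j" "of_int i'" "of_int j'"] assms by simp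

lemma L_closed:
  "x \<in> L \<Longrightarrow> y \<in> L \<Longrightarrow> x + y \<in> L" "x \<in> L \<Longrightarrow> y \<in> L \<Longrightarrow> x * y \<in> L" "of_int i \<in> L"
proof -
  assume "x \<in> L" "y \<in> L"
  then obtain i j i' j' where xy: "x = of_int i + of_int j * s" "y = of_int i' + of_int j' * s"
    by (auto simp: L_def)
  have "x + y = of_int (i + i') + of_int (j + j') * s" by (simp add: xy algebra_simps)
  then show "x + y \<in> L" unfolding L_def by blast
  have "x * y = of_int i * of_int i' + of_int j * of_int j' * (s * s) + (of_int i * of_int j' + of_int j * of_int i') * s"
    by (simp add: xy algebra_simps)
  then have "x * y = of_int (i * i' + j * j' * D) + of_int (i * j' + j * i') * s" by (simp add: s_sq)
  then show "x * y \<in> L" unfolding L_def by blast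
next
  have "of_int i = of_int i + of_int 0 * s" by simp
  then show "of_int i \<in> L" unfolding L_def by blast
qed

lemma L_power: "x \<in> L \<Longrightarrow> x ^ k \<in> L"
  using L_closed(3)[of 1] by (induction k) (auto intro: L_closed)

lemma L_sum: "(\<And>i. i \<in> A \<Longrightarrow> f i \<in> L) \<Longrightarrow> sum f A \<in> L"
  using L_closed(3)[of 0] by (induction A rule: infinite_finite_induct) (auto intro: L_closed)

lemma algebraic_int_bounded_denominator:
  assumes "algebraic_int x" "x = of_rat q + of_rat r * s"
  obtains M :: int where "M \<noteq> 0" "\<And>k. of_int M * x ^ k \<in> L"
proof -
  obtain P :: "int poly" where P: "poly (map_poly of_int P) x = 0" "lead_coeff P = 1"
    using assms(1) by (auto simp: algebraic_int_altdef_ipoly)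
  define n where "n = degree P"
  obtain u w where q: "q = of_int u / of_int w" "w > (0::int)"
    using rat_fraction[of q] by blast
  obtain u' w' where r: "r = of_int u' / of_int w'" "w' > (0::int)"
    using rat_fraction[of r] by blast
  define e where "e = w * w'"
  have "of_int e * x = of_int (u * w') + of_int (u' * w) * s"
  proof -
    have "of_rat q = (of_int u / of_int w :: real)" "of_rat r = (of_int u' / of_int w' :: real)"
      by (simp_all add: q r of_rat_divide)
    then show ?thesis using q(2) r(2) by (simp add: assms(2) e_def field_simps)
  qed
  then have ex: "of_int e * x \<in> L" unfolding L_def by blast
  have le: "of_int (e ^ n) * x ^ k \<in> L" if "k \<le> n" for k
  proof -
    have "of_int (e ^ n) * x ^ k = of_int (e ^ (n - k)) * (of_int e * x) ^ k"
      using that by (simp add: power_mult_distrib flip: power_add mult.assoc)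
    then show ?thesis by (simp only: L_closed(2)[OF L_closed(3) L_power[OF ex]])
  qed
  have "0 = (\<Sum>i\<le>n. of_int (coeff P i) * x ^ i)"
    using P(1) by (simp add: poly_altdef n_def degree_map_poly coeff_map_poly)
  also have "\<dots> = x ^ n + (\<Sum>i<n. of_int (coeff P i) * x ^ i)"
    using P(2) by (simp add: n_def flip: lessThan_Suc_atMost)
  finally have xn: "x ^ n = - (\<Sum>i<n. of_int (coeff P i) * x ^ i)" by simp
  have all: "of_int (e ^ n) * x ^ k \<in> L" for k
  proof (induction k rule: less_induct)
    case (less k)
    show ?case
    proof (cases "k \<le> n")
      case False
      have "of_int (e ^ n) * x ^ k = of_int (e ^ n) * (x ^ (k - n) * x ^ n)"
        using False by (simp flip: power_add)
      also have "\<dots> = (\<Sum>i<n. of_int (- coeff P i) * (of_int (e ^ n) * x ^ (k - n + i)))"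
        by (simp add: xn sum_distrib_left power_add algebra_simps sum_negf)
      also have "\<dots> \<in> L" using False by (intro L_sum L_closed(2)[OF L_closed(3)] less.IH) auto
      finally show ?thesis .
    qed (simp only: le)
  qed
  show ?thesis using that[of "e ^ n"] all q r by (simp add: e_def)
qed

lemma norm_int:
  assumes "M \<noteq> 0" "\<And>k. of_int M * (of_rat q + of_rat r * s) ^ k \<in> L"
  shows "q * q - of_int D * (r * r) \<in> \<int>"
proof (rule bounded_denominator_imp_int)
  show "q * q - of_int D * (r * r) \<in> \<rat>"
    using rat_fraction[of "q * q - of_int D * (r * r)"] by (metis Rats_divide Rats_of_int)
  show "M * M \<noteq> 0" using assms by simp
  fix k
  have "\<exists>q' r'. (of_rat q + of_rat r * s) ^ k = of_rat q' + of_rat r' * s \<and>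
      q' * q' - of_int D * (r' * r') = (q * q - of_int D * (r * r)) ^ k"
  proof (induction k)
    case 0
    show ?case by (intro exI[of _ 1] exI[of _ 0]) simp
  next
    case (Suc k)
    then obtain q' r' where IH: "(of_rat q + of_rat r * s) ^ k = of_rat q' + of_rat r' * s"
      "q' * q' - of_int D * (r' * r') = (q * q - of_int D * (r * r)) ^ k" by blast
    have "(of_rat q + of_rat r * s) ^ Suc k = of_rat q * of_rat q' + of_rat r * of_rat r' * (s * s)
        + (of_rat q * of_rat r' + of_rat r * of_rat q') * s"
      unfolding power_Suc IH(1) by (simp add: algebra_simps)
    also have "\<dots> = of_rat (q * q' + r * r' * of_int D) + of_rat (q * r' + r * q') * s"
      by (simp add: s_sq of_rat_add of_rat_mult)
    finally have "(of_rat q + of_rat r * s) ^ Suc k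
        = of_rat (q * q' + r * r' * of_int D) + of_rat (q * r' + r * q') * s" .
    moreover have "(q * q' + r * r' * of_int D) * (q * q' + r * r' * of_int D)
        - of_int D * ((q * r' + r * q') * (q * r' + r * q'))
        = (q * q - of_int D * (r * r)) * (q' * q' - of_int D * (r' * r'))"
      by (simp add: algebra_simps)
    ultimately show ?case unfolding IH(2) power_Suc by blast
  qed
  then obtain q' r' where qr: "(of_rat q + of_rat r * s) ^ k = of_rat q' + of_rat r' * s"
      "q' * q' - of_int D * (r' * r') = (q * q - of_int D * (r * r)) ^ k" by blast
  obtain i j where "of_int M * (of_rat q' + of_rat r' * s) = of_int i + of_int j * s"
    using assms(2)[of k] by (auto simp: qr L_def)
  then have ij: "of_int M * q' = of_int i" "of_int M * r' = of_int j"
    using coords_unique[of "of_int M * q'" "of_int M * r'" "of_int i" "of_int j"]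
    by (auto simp: of_rat_mult algebra_simps)
  have "of_int (M * M) * (q * q - of_int D * (r * r)) ^ k
      = (of_int M * q') * (of_int M * q') - of_int D * ((of_int M * r') * (of_int M * r'))"
    unfolding qr(2)[symmetric] by (simp add: algebra_simps)
  also have "\<dots> = of_int (i * i - D * (j * j))" unfolding ij by simp
  finally show "of_int (M * M) * (q * q - of_int D * (r * r)) ^ k \<in> \<int>" by simp
qed

text \<open>The trace is integral because the norms of \<open>x\<close> and \<open>x + 1\<close> are.\<close>

lemma algebraic_int_trace_norm:
  assumes "algebraic_int x" "x = of_rat q + of_rat r * s"
  shows "2 * q \<in> \<int>" "q * q - of_int D * (r * r) \<in> \<int>"
proof -
  obtain M :: int where M: "M \<noteq> 0" "\<And>k. of_int M * x ^ k \<in> L"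
    using algebraic_int_bounded_denominator[OF assms] by blast
  show n: "q * q - of_int D * (r * r) \<in> \<int>" using norm_int[OF M(1)] M(2) assms(2) by blast
  have "of_int M * (of_rat (q + 1) + of_rat r * s) ^ k \<in> L" for k
  proof -
    have "of_int M * (of_rat (q + 1) + of_rat r * s) ^ k = of_int M * (x + 1) ^ k"
      by (simp add: assms(2) of_rat_add algebra_simps)
    also have "\<dots> = of_int M * (\<Sum>i\<le>k. of_nat (k choose i) * x ^ i * 1 ^ (k - i))"
      by (simp only: binomial_ring)
    also have "\<dots> = (\<Sum>i\<le>k. of_int (int (k choose i)) * (of_int M * x ^ i))"
      by (simp add: sum_distrib_left algebra_simps)
    also have "\<dots> \<in> L" by (intro L_sum L_closed(2)[OF L_closed(3)] M(2))
    finally show ?thesis .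
  qed
  then have "(q + 1) * (q + 1) - of_int D * (r * r) \<in> \<int>" using norm_int[OF M(1)] by blast
  from Ints_diff[OF Ints_diff[OF this n] Ints_1] show "2 * q \<in> \<int>" by (simp add: algebra_simps)
qed

end

lemma squarefree_mult_square_int:
  fixes m :: nat and r :: rat
  assumes "squarefree m" "of_nat m * (r * r) \<in> \<int>"
  shows "r \<in> \<int>"
proof -
  obtain u w :: int where uw: "0 < w" "Rings.coprime u w" "r = of_int u / of_int w"
    by (cases r) (auto simp: Fract_of_int_quotient intro: that)
  obtain A where "of_nat m * (r * r) = of_int A" using assms(2) by (auto elim: Ints_cases)
  then have "of_int (int m * (u * u)) = (of_int (A * (w * w)) :: rat)"
    using uw by (simp add: field_simps)
  then have "int m * (u * u) = A * (w * w)" by (simp only: of_int_eq_iff)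
  then have "w\<^sup>2 dvd int m * u\<^sup>2" by (simp add: power2_eq_square)
  moreover have "Rings.coprime (w\<^sup>2) (u\<^sup>2)" using uw by (simp add: coprime_commute)
  ultimately have "w\<^sup>2 dvd int m" by (simp add: coprime_dvd_mult_left_iff)
  then have "int ((nat w)\<^sup>2) dvd int m" using uw by simp
  then have "(nat w)\<^sup>2 dvd m" by (simp only: int_dvd_int_iff)
  then have "nat w dvd 1" using squarefreeD assms(1) by blast
  then have "w = 1" using uw by simp
  then show ?thesis using uw by simp
qed

locale quadratic_order = irrational_sqrt +
  fixes K :: "real set"
  assumes K_eq: "K = {of_rat q + of_rat r * s | q r. True}"
    and D_mod: "D mod 4 = 0 \<or> D mod 4 = 1"
    and O_eq: "{x \<in> K. algebraic_int x} = {(of_int i + of_int j * s) / 2 | i j. even (i - j * D)}"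

lemma real_quadratic_field_order:
  assumes "real_quadratic_field K"
  obtains D s where "quadratic_order D s K"
proof -
  obtain m :: nat where m: "squarefree m" "sqrt m \<notin> \<rat>" "K = {of_rat q + of_rat r * sqrt m | q r. True}"
    using real_quadratic_field_sqrt[OF assms] .
  interpret M: irrational_sqrt "int m" "sqrt m" by unfold_locales (use m in auto)
  define e :: int where "e = (if m mod 4 = 1 then 1 else 2)"
  define D where "D = e * e * int m"
  define s where "s = of_int e * sqrt m"
  have e: "e \<noteq> 0" by (simp add: e_def)
  have m4: "m mod 4 \<noteq> 0"
  proof
    assume "m mod 4 = 0"
    then have "2\<^sup>2 dvd m" by (simp add: dvd_eq_mod_eq_0)
    then show False using squarefreeD[OF m(1), of 2] by simp
  qed
  have s_sq: "s * s = of_int D" by (simp add: s_def D_def)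
  have s_irr: "s \<notin> \<rat>"
  proof
    assume "s \<in> \<rat>"
    then have "s / of_int e \<in> \<rat>" by simp
    then show False using m(2) e by (simp add: s_def)
  qed
  have K: "K = {of_rat q + of_rat r * s | q r. True}"
  proof (intro equalityI subsetI)
    fix x assume "x \<in> K"
    then obtain q r where x: "x = of_rat q + of_rat r * sqrt m" using m(3) by blast
    have "x = of_rat q + of_rat (r / of_int e) * s" using e by (simp add: x s_def of_rat_divide)
    then show "x \<in> {of_rat q + of_rat r * s | q r. True}" by (intro CollectI exI conjI TrueI)
  next
    fix x assume "x \<in> {of_rat q + of_rat r * s | q r. True}"
    then obtain q r where x: "x = of_rat q + of_rat r * s" by blast
    have "x = of_rat q + of_rat (r * of_int e) * sqrt m" by (simp add: x s_def of_rat_mult)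
    then show "x \<in> K" unfolding m(3) by (intro CollectI exI conjI TrueI)
  qed
  have Dmod: "D mod 4 = 0 \<or> D mod 4 = 1"
  proof (cases "m mod 4 = 1")
    case True
    then have "int m mod 4 = 1" by presburger
    then show ?thesis using True by (simp add: D_def e_def)
  qed (simp add: D_def e_def)
  have O: "{x \<in> K. algebraic_int x} = {(of_int i + of_int j * s) / 2 | i j. even (i - j * D)}"
  proof (intro equalityI subsetI)
    fix x assume "x \<in> {x \<in> K. algebraic_int x}"
    then have ax: "algebraic_int x" and "x \<in> K" by auto
    then obtain q r where x: "x = of_rat q + of_rat r * sqrt m" using m(3) by blast
    have tn: "2 * q \<in> \<int>" "q * q - of_int (int m) * (r * r) \<in> \<int>"
      using M.algebraic_int_trace_norm[OF ax x] by auto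
    have "of_nat m * ((2 * r) * (2 * r)) = (2 * q) * (2 * q) - 4 * (q * q - of_int (int m) * (r * r))"
      by (simp add: algebra_simps)
    also have "\<dots> \<in> \<int>" by (intro Ints_diff Ints_mult tn) auto
    finally have "2 * r \<in> \<int>" by (rule squarefree_mult_square_int[OF m(1)])
    then obtain J where J: "2 * r = of_int J" by (auto elim: Ints_cases)
    obtain i where i: "2 * q = of_int i" using tn by (auto elim: Ints_cases)
    obtain N where N: "q * q - of_int (int m) * (r * r) = of_int N" using tn by (auto elim: Ints_cases)
    have "(of_int (i * i - int m * (J * J)) :: rat) = (2 * q) * (2 * q) - of_int (int m) * ((2 * r) * (2 * r))"
      unfolding i J by simp
    also have "\<dots> = 4 * (q * q - of_int (int m) * (r * r))" by (simp add: algebra_simps)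
    also have "\<dots> = of_int (4 * N)" unfolding N by simp
    finally have iJ: "i * i - int m * (J * J) = 4 * N" by (simp only: of_int_eq_iff)
    have qr: "q = of_int i / 2" "r = of_int J / 2" using i J by auto
    have x2: "x = (of_int i + of_int J * sqrt m) / 2"
      by (simp add: x qr of_rat_divide add_divide_distrib)
    show "x \<in> {(of_int i + of_int j * s) / 2 | i j. even (i - j * D)}"
    proof (cases "m mod 4 = 1")
      case True
      have "odd m" using True by presburger
      moreover have "even (i * i - int m * (J * J))" using iJ by simp
      ultimately have "even (i - J * D)" using True by (simp add: D_def e_def)
      moreover have "x = (of_int i + of_int J * s) / 2" using True by (simp add: x2 s_def e_def)
      ultimately show ?thesis by blast
    next
      case False
      have "even J"
      proof (rule ccontr)
        assume "odd J"
        then have "J mod 4 = 1 \<or> J mod 4 = 3" by presburger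
        moreover have "(J * J) mod 4 = ((J mod 4) * (J mod 4)) mod 4" by (simp add: mod_mult_eq)
        ultimately have JJ: "(J * J) mod 4 = 1" by auto
        have "(i * i) mod 4 = (int m * (J * J)) mod 4" using iJ by (simp add: mod_eq_dvd_iff)
        also have "\<dots> = int m mod 4" unfolding mod_mult_right_eq[of "int m" "J * J" 4, symmetric] JJ by simp
        finally have ii: "(i * i) mod 4 = int m mod 4" .
        have "i mod 4 = 0 \<or> i mod 4 = 1 \<or> i mod 4 = 2 \<or> i mod 4 = 3" by presburger
        moreover have "(i * i) mod 4 = ((i mod 4) * (i mod 4)) mod 4" by (simp add: mod_mult_eq)
        ultimately have "(i * i) mod 4 = 0 \<or> (i * i) mod 4 = 1" by auto
        then have "int m mod 4 = 0 \<or> int m mod 4 = 1" using ii by simp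
        then show False using False m4 by presburger
      qed
      then obtain j where j: "J = 2 * j" by blast
      have "i * i = 2 * (2 * N + 2 * (int m * (j * j)))" using iJ j by (simp add: algebra_simps)
      then have "even (i * i)" by (rule dvdI)
      then have "even (i - j * D)" using False by (simp add: D_def e_def)
      moreover have "x = (of_int i + of_int j * s) / 2" using False by (simp add: x2 j s_def e_def)
      ultimately show ?thesis by blast
    qed
  next
    fix x assume "x \<in> {(of_int i + of_int j * s) / 2 | i j. even (i - j * D)}"
    then obtain i j where x: "x = (of_int i + of_int j * s) / 2" and ij: "even (i - j * D)" by blast
    have "x = of_rat (of_int i / 2) + of_rat (of_int j / 2) * s"
      by (simp add: x of_rat_divide add_divide_distrib)
    then have "x \<in> K" unfolding K by (intro CollectI exI conjI TrueI)
    have "4 dvd D \<or> 4 dvd D - 1" using Dmod by presburger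
    then have D4: "4 dvd D * (D - 1)" by auto
    have "even (i + j * D)" using ij by simp
    then have "2 * 2 dvd (i - j * D) * (i + j * D)" using ij by (intro mult_dvd_mono)
    then have "4 dvd (i - j * D) * (i + j * D) + D * (D - 1) * (j * j)" using D4 by simp
    also have "(i - j * D) * (i + j * D) + D * (D - 1) * (j * j) = i * i - D * (j * j)"
      by (simp add: algebra_simps)
    finally obtain N where N: "i * i - D * (j * j) = 4 * N" by blast
    have "of_int i * of_int i - s * s * (of_int j * of_int j) = (4 * of_int N :: real)"
    proof -
      have "(of_int (i * i - D * (j * j)) :: real) = of_int (4 * N)" unfolding N ..
      then show ?thesis unfolding s_sq by simp
    qed
    moreover have "x * x - of_int i * x + of_int N = of_int N - (of_int i * of_int i - s * s * (of_int j * of_int j)) / 4"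
      by (simp add: x field_simps)
    ultimately have "x * x - of_int i * x + of_int N = 0" by simp
    then have root: "poly [:of_int N, - of_int i, 1:] x = 0" by (simp add: algebra_simps)
    have coeffs: "\<forall>k. coeff [:of_int N, - of_int i, 1 :: real:] k \<in> \<int>"
      by (auto simp: coeff_pCons split: nat.splits)
    have "lead_coeff [:of_int N, - of_int i, 1 :: real:] = 1" by simp
    then have "algebraic_int x" using coeffs root by (rule algebraic_int.intros)
    then show "x \<in> {x \<in> K. algebraic_int x}" using \<open>x \<in> K\<close> by simp
  qed
  have "quadratic_order D s K"
    by (intro quadratic_order.intro irrational_sqrt.intro quadratic_order_axioms.intro
        s_sq s_irr K Dmod O)
  then show ?thesis by (rule that)
qed

context quadratic_order
begin

lemma s_nonzero: "s \<noteq> 0"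
  using s_irr by auto

lemma K_closed:
  "of_rat q \<in> K" "s \<in> K" "x \<in> K \<Longrightarrow> y \<in> K \<Longrightarrow> x + y \<in> K" "x \<in> K \<Longrightarrow> y \<in> K \<Longrightarrow> x * y \<in> K"
proof -
  have "of_rat q = of_rat q + of_rat 0 * s" by simp
  then show "of_rat q \<in> K" unfolding K_eq by (intro CollectI exI conjI TrueI)
  have "s = of_rat 0 + of_rat 1 * s" by simp
  then show "s \<in> K" unfolding K_eq by (intro CollectI exI conjI TrueI)
next
  assume "x \<in> K" "y \<in> K"
  then obtain q r q' r' where xy: "x = of_rat q + of_rat r * s" "y = of_rat q' + of_rat r' * s"
    unfolding K_eq by blast
  have "x + y = of_rat (q + q') + of_rat (r + r') * s" by (simp add: xy of_rat_add algebra_simps)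
  then show "x + y \<in> K" unfolding K_eq by (intro CollectI exI conjI TrueI)
  have "x * y = of_rat q * of_rat q' + of_rat r * of_rat r' * (s * s) + (of_rat q * of_rat r' + of_rat r * of_rat q') * s"
    by (simp add: xy algebra_simps)
  also have "\<dots> = of_rat (q * q' + r * r' * of_int D) + of_rat (q * r' + r * q') * s"
    by (simp add: s_sq of_rat_add of_rat_mult)
  finally show "x * y \<in> K" unfolding K_eq by (intro CollectI exI conjI TrueI)
qed

definition cj :: "real \<Rightarrow> real" where
  "cj x = (SOME y. \<exists>q r. x = of_rat q + of_rat r * s \<and> y = of_rat q - of_rat r * s)"

lemma cj: "cj (of_rat q + of_rat r * s) = of_rat q - of_rat r * s"
  unfolding cj_def by (rule some_equality) (use coords_unique in blast)+

lemma real_embeddings: "real_embeddings K = {restrict id K, restrict cj K}"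
proof (intro equalityI subsetI)
  fix \<sigma> assume "\<sigma> \<in> real_embeddings K"
  then have h: "\<sigma> \<in> ring_hom (real_ring\<lparr>carrier := K\<rparr>) real_ring" and ext: "\<sigma> \<in> extensional K"
    by (auto simp: real_embeddings_def)
  have hom: "\<sigma> (x * y) = \<sigma> x * \<sigma> y" "\<sigma> (x + y) = \<sigma> x + \<sigma> y" if "x \<in> K" "y \<in> K" for x y
    using ring_hom_mult[OF h] ring_hom_add[OF h] that by simp_all
  have one: "\<sigma> 1 = 1" using ring_hom_one[OF h] by simp
  have in_K: "of_nat n \<in> K" "of_int i \<in> K" for n i
    using K_closed(1)[of "of_nat n"] K_closed(1)[of "of_int i"] by simp_all
  have zero: "\<sigma> 0 = 0" using hom(2)[of 0 0] in_K(1)[of 0] by simp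
  have nat: "\<sigma> (of_nat n) = of_nat n" for n
  proof (induction n)
    case (Suc n)
    then show ?case using hom(2)[of 1 "of_nat n"] in_K(1)[of 1] in_K(1)[of n] one by simp
  qed (simp add: zero)
  have int: "\<sigma> (of_int i) = of_int i" for i
  proof (cases "0 \<le> i")
    case True
    then show ?thesis using nat[of "nat i"] by simp
  next
    case False
    have "\<sigma> (of_int i) + \<sigma> (of_nat (nat (- i))) = \<sigma> (of_int i + of_nat (nat (- i)))"
      using hom(2) in_K by simp
    then show ?thesis unfolding nat using False zero by simp
  qed
  have rat: "\<sigma> (of_rat q) = of_rat q" for q
  proof -
    obtain u w :: int where q: "0 < w" "q = of_int u / of_int w" by (rule rat_fraction)
    have e: "of_rat q * of_int w = (of_int u :: real)" using q by (simp add: of_rat_divide)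
    have "\<sigma> (of_rat q) * of_int w = of_int u"
      using hom(1)[OF K_closed(1)[of q] in_K(2)[of w]] unfolding e int by simp
    then have "\<sigma> (of_rat q) * of_int w = of_rat q * of_int w" using e by simp
    then show ?thesis using q by simp
  qed
  have "\<sigma> s * \<sigma> s = s * s"
    using hom(1)[OF K_closed(2,2)] unfolding s_sq int by simp
  then have "\<sigma> s = s \<or> \<sigma> s = - s" by (simp add: square_eq_iff)
  moreover have \<sigma>: "\<sigma> (of_rat q + of_rat r * s) = of_rat q + of_rat r * \<sigma> s" for q r
    using hom K_closed rat by simp
  ultimately consider "\<sigma> s = s" | "\<sigma> s = - s" by blast
  then show "\<sigma> \<in> {restrict id K, restrict cj K}"
  proof cases
    case 1
    have "\<sigma> = restrict id K"
      by (rule extensionalityI[OF ext restrict_extensional]) (use 1 \<sigma> in \<open>auto simp: K_eq\<close>)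
    then show ?thesis by simp
  next
    case 2
    have "\<sigma> = restrict cj K"
      by (rule extensionalityI[OF ext restrict_extensional]) (use 2 \<sigma> in \<open>auto simp: K_eq cj\<close>)
    then show ?thesis by simp
  qed
next
  fix \<sigma> assume \<sigma>: "\<sigma> \<in> {restrict id K, restrict cj K}"
  have one: "1 \<in> K" using K_closed(1)[of 1] by simp
  have cj1: "cj 1 = 1" using cj[of 1 0] by simp
  have "cj (x + y) = cj x + cj y \<and> cj (x * y) = cj x * cj y" if K: "x \<in> K" "y \<in> K" for x y
  proof -
    obtain q r q' r' where xy: "x = of_rat q + of_rat r * s" "y = of_rat q' + of_rat r' * s"
      using K unfolding K_eq by blast
    have sum: "x + y = of_rat (q + q') + of_rat (r + r') * s" by (simp add: xy of_rat_add algebra_simps)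
    have "x * y = of_rat q * of_rat q' + of_rat r * of_rat r' * (s * s) + (of_rat q * of_rat r' + of_rat r * of_rat q') * s"
      by (simp add: xy algebra_simps)
    then have prod: "x * y = of_rat (q * q' + r * r' * of_int D) + of_rat (q * r' + r * q') * s"
      by (simp add: s_sq of_rat_add of_rat_mult)
    have "cj x * cj y = of_rat q * of_rat q' + of_rat r * of_rat r' * (s * s) - (of_rat q * of_rat r' + of_rat r * of_rat q') * s"
      unfolding xy cj by (simp add: algebra_simps)
    then have m: "cj x * cj y = cj (x * y)"
      unfolding prod cj by (simp add: s_sq of_rat_add of_rat_mult)
    have "cj (x + y) = of_rat (q + q') - of_rat (r + r') * s" unfolding sum by (rule cj)
    moreover have "cj x = of_rat q - of_rat r * s" "cj y = of_rat q' - of_rat r' * s"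
      unfolding xy by (rule cj)+
    ultimately have "cj (x + y) = cj x + cj y"
      by (simp only: of_rat_add) (simp add: algebra_simps)
    with m show ?thesis by simp
  qed
  then show "\<sigma> \<in> real_embeddings K"
    using \<sigma> one cj1 K_closed(3,4) by (auto simp: real_embeddings_def ring_hom_def)
qed

lemma field_trace: "field_trace K (of_rat q + of_rat r * s) = 2 * of_rat q"
proof -
  let ?x = "of_rat q + of_rat r * s"
  have x: "?x \<in> K" by (intro K_closed)
  have "restrict id K s \<noteq> restrict cj K s"
    using cj[of 0 1] K_closed(2) s_nonzero by simp
  then have "restrict id K \<noteq> restrict cj K" by metis
  then have "field_trace K ?x = restrict id K ?x + restrict cj K ?x"
    unfolding field_trace_def real_embeddings by simp
  then show ?thesis using x by (simp add: cj)
qed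

lemma trace_mult:
  "field_trace K ((of_int i + of_int j * s) / 2 * ((of_int i' + of_int j' * s) / 2)) = of_int (i * i' + j * j' * D) / 2"
proof -
  let ?x = "(of_int i + of_int j * s) / 2 * ((of_int i' + of_int j' * s) / 2)"
  have "?x = (of_int i * of_int i' + of_int j * of_int j' * (s * s)) / 4 + (of_int i * of_int j' + of_int j * of_int i') / 4 * s"
    by (simp add: field_simps)
  also have "\<dots> = of_rat (of_int (i * i' + j * j' * D) / 4) + of_rat (of_int (i * j' + j * i') / 4) * s"
    by (simp add: s_sq of_rat_divide of_rat_add of_rat_mult)
  finally have e: "?x = of_rat (of_int (i * i' + j * j' * D) / 4) + of_rat (of_int (i * j' + j * i') / 4) * s" .
  show ?thesis unfolding e field_trace by (simp add: of_rat_divide of_rat_add of_rat_mult)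
qed

lemma integral_basis_discriminant:
  assumes "integral_basis K w1 w2"
  shows "field_trace K (w1 * w1) * field_trace K (w2 * w2)
    - field_trace K (w1 * w2) * field_trace K (w2 * w1) = of_int D"
proof -
  have "w1 \<in> {x \<in> K. algebraic_int x}" "w2 \<in> {x \<in> K. algebraic_int x}"
    using assms by (auto simp: integral_basis_def)
  then obtain i j i' j' where w: "w1 = (of_int i + of_int j * s) / 2" "even (i - j * D)"
    "w2 = (of_int i' + of_int j' * s) / 2" "even (i' - j' * D)"
    unfolding O_eq by blast
  have gen: "\<exists>m n. i0 = m * i + n * i' \<and> j0 = m * j + n * j'" if "even (i0 - j0 * D)" for i0 j0
  proof -
    have "(of_int i0 + of_int j0 * s) / 2 \<in> {x \<in> K. algebraic_int x}" unfolding O_eq using that by blast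
    then have "\<exists>!(m, n). (of_int i0 + of_int j0 * s) / 2 = of_int m * w1 + of_int n * w2"
      using assms unfolding integral_basis_def ring_of_integers_simps by blast
    then obtain m n where "(of_int i0 + of_int j0 * s) / 2 = of_int m * w1 + of_int n * w2"
      by (auto dest!: ex1_implies_ex)
    then have "of_int i0 + of_int j0 * s = of_int (m * i + n * i') + of_int (m * j + n * j') * s"
      by (simp add: w field_simps)
    then show ?thesis using int_coords_unique by blast
  qed
  obtain m n where 1: "2 = m * i + n * i'" "0 = m * j + n * j'" using gen[of 2 0] by auto
  obtain m' n' where 2: "D = m' * i + n' * i'" "1 = m' * j + n' * j'" using gen[of D 1] by auto
  have d: "2 * 1 - 0 * D = (m * n' - m' * n) * (i * j' - i' * j)"
    unfolding 1 2 by (simp add: algebra_simps)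
  obtain k k' where "i - j * D = 2 * k" "i' - j' * D = 2 * k'" using w by blast
  then have k: "i = j * D + 2 * k" "i' = j' * D + 2 * k'" by simp_all
  obtain t where t: "i * j' - i' * j = 2 * t"
    using that[of "k * j' - k' * j"] by (simp add: k algebra_simps)
  define z where "z = (m * n' - m' * n) * t"
  have "2 = 2 * z" using d unfolding t z_def by (simp add: algebra_simps)
  then have "(m * n' - m' * n) * t = 1" unfolding z_def by linarith
  then have "t = 1 \<or> t = - 1" by (metis zmult_eq_1_iff)
  then have "t * t = 1" by auto
  have "of_int (i * i + j * j * D) / 2 * (of_int (i' * i' + j' * j' * D) / 2)
      - of_int (i * i' + j * j' * D) / 2 * (of_int (i' * i + j' * j * D) / 2)
     = (of_int (D * (i * j' - i' * j)\<^sup>2) / 4 :: real)"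
    by (simp add: field_simps power2_eq_square)
  also have "D * (i * j' - i' * j)\<^sup>2 = 4 * D"
    using \<open>t * t = 1\<close> by (simp add: t power2_eq_square)
  finally show ?thesis unfolding w trace_mult by simp
qed

lemma exists_integral_basis: "integral_basis K 1 ((of_int D + s) / 2)"
proof -
  let ?w = "(of_int D + s) / 2"
  have "(of_int 2 + of_int 0 * s) / 2 \<in> {x \<in> K. algebraic_int x}"
    "(of_int D + of_int 1 * s) / 2 \<in> {x \<in> K. algebraic_int x}"
    unfolding O_eq by (rule CollectI, intro exI conjI, rule refl, simp)+
  then have mem: "1 \<in> {x \<in> K. algebraic_int x}" "?w \<in> {x \<in> K. algebraic_int x}" by simp_all
  have "\<exists>!(m, n). x = of_int m * 1 + of_int n * ?w" if "x \<in> {x \<in> K. algebraic_int x}" for x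
  proof -
    obtain i j where x: "x = (of_int i + of_int j * s) / 2" "even (i - j * D)"
      using \<open>x \<in> _\<close> unfolding O_eq by blast
    then obtain k where "i - j * D = 2 * k" by blast
    then have k: "i = j * D + 2 * k" by simp
    have *: "x = of_int m * 1 + of_int n * ?w \<longleftrightarrow> (m, n) = (k, j)" for m n
    proof -
      have "x = of_int m * 1 + of_int n * ?w \<longleftrightarrow>
          of_int i + of_int j * s = of_int (2 * m + n * D) + of_int n * s"
        by (simp add: x field_simps)
      also have "\<dots> \<longleftrightarrow> i = 2 * m + n * D \<and> j = n" using int_coords_unique by blast
      finally show ?thesis by (auto simp: k)
    qed
    show ?thesis
      by (rule ex1I[of _ "(k, j)"]) (simp_all only: case_prod_beta * prod.collapse fst_conv snd_conv)
  qed
  then show ?thesis using mem by (simp add: integral_basis_def)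
qed

lemma field_discriminant: "field_discriminant K = D"
  unfolding field_discriminant_def
proof (rule the_equality)
  show "\<exists>w1 w2. integral_basis K w1 w2 \<and> real_of_int D = field_trace K (w1 * w1) * field_trace K (w2 * w2)
      - field_trace K (w1 * w2) * field_trace K (w2 * w1)"
    using exists_integral_basis integral_basis_discriminant by metis
next
  fix d assume "\<exists>w1 w2. integral_basis K w1 w2 \<and> real_of_int d = field_trace K (w1 * w1) * field_trace K (w2 * w2)
      - field_trace K (w1 * w2) * field_trace K (w2 * w1)"
  then show "d = D" using integral_basis_discriminant by (metis of_int_eq_iff)
qed

end

subsection \<open>Forms, ideals and class number one\<close>

locale quadratic_form = quadratic_order +
  fixes a b c :: int
  assumes disc: "b\<^sup>2 - 4 * a * c = D"
begin

definition \<theta> :: real where "\<theta> = (of_int b + s) / 2"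

lemma theta_sq: "\<theta> * \<theta> = of_int b * \<theta> - of_int (a * c)"
proof -
  have "s * s = of_int b * of_int b - 4 * of_int a * of_int c"
    unfolding s_sq disc[symmetric] by (simp add: power2_eq_square)
  then show ?thesis by (simp add: \<theta>_def field_simps)
qed

lemma leading_coeff_nonzero: "a \<noteq> 0"
proof
  assume "a = 0"
  then have "s * s = of_int b * of_int b" unfolding s_sq disc[symmetric] by (simp add: power2_eq_square)
  then have "s = of_int b \<or> s = - of_int b" by (simp add: square_eq_iff)
  then show False using s_irr by auto
qed

lemma b_parity: "even (b - D)"
proof -
  have "b\<^sup>2 - D = 2 * (2 * a * c)" using disc by simp
  then have "even (b\<^sup>2 - D)" by simp
  then show ?thesis by simp
qed

lemma O_theta: "{x \<in> K. algebraic_int x} = {of_int m + of_int n * \<theta> | m n. True}"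
proof (intro equalityI subsetI)
  fix x assume "x \<in> {x \<in> K. algebraic_int x}"
  then obtain i j where x: "x = (of_int i + of_int j * s) / 2" "even (i - j * D)" unfolding O_eq by blast
  have "even (i - j * b)" using x(2) b_parity by auto
  then obtain k where k: "i - j * b = 2 * k" by blast
  then have "i = 2 * k + j * b" by simp
  then have "x = of_int k + of_int j * \<theta>" by (simp add: x \<theta>_def field_simps)
  then show "x \<in> {of_int m + of_int n * \<theta> | m n. True}" by blast
next
  fix x assume "x \<in> {of_int m + of_int n * \<theta> | m n. True}"
  then obtain m n where x: "x = of_int m + of_int n * \<theta>" by blast
  have "x = (of_int (2 * m + n * b) + of_int n * s) / 2" by (simp add: x \<theta>_def field_simps)
  moreover have "even (2 * m + n * b - n * D)" using b_parity by auto
  ultimately show "x \<in> {x \<in> K. algebraic_int x}" unfolding O_eq by blast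
qed

lemma theta_unique:
  assumes "of_int m + of_int n * \<theta> = of_int m' + of_int n' * \<theta>"
  shows "m = m' \<and> n = n'"
proof -
  have "of_int (2 * m + n * b) + of_int n * s = of_int (2 * m' + n' * b) + of_int n' * s"
    using assms by (simp add: \<theta>_def field_simps)
  then show ?thesis using int_coords_unique by fastforce
qed

lemma theta_mult: "(of_int m + of_int n * \<theta>) * (of_int m' + of_int n' * \<theta>) =
    of_int (m * m' - n * n' * (a * c)) + of_int (m * n' + n * m' + n * n' * b) * \<theta>"
proof -
  have "(of_int m + of_int n * \<theta>) * (of_int m' + of_int n' * \<theta>) =
    of_int m * of_int m' + (of_int m * of_int n' + of_int n * of_int m') * \<theta> + of_int n * of_int n' * (\<theta> * \<theta>)"
    by (simp add: algebra_simps)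
  then show ?thesis by (simp add: theta_sq algebra_simps)
qed

lemma ring_of_integers: "ring (ring_of_integers K)"
proof (rule ringI)
  have cl: "x + y \<in> {x \<in> K. algebraic_int x}" "x * y \<in> {x \<in> K. algebraic_int x}" "- x \<in> {x \<in> K. algebraic_int x}"
    if O: "x \<in> {x \<in> K. algebraic_int x}" "y \<in> {x \<in> K. algebraic_int x}" for x y
  proof -
    obtain m n m' n' where xy: "x = of_int m + of_int n * \<theta>" "y = of_int m' + of_int n' * \<theta>"
      using O unfolding O_theta by blast
    have "x + y = of_int (m + m') + of_int (n + n') * \<theta>" by (simp add: xy algebra_simps)
    then show "x + y \<in> {x \<in> K. algebraic_int x}" unfolding O_theta by blast
    show "x * y \<in> {x \<in> K. algebraic_int x}" unfolding O_theta xy theta_mult by blast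
    have "- x = of_int (- m) + of_int (- n) * \<theta>" by (simp add: xy algebra_simps)
    then show "- x \<in> {x \<in> K. algebraic_int x}" unfolding O_theta by blast
  qed
  have "0 = of_int 0 + of_int 0 * \<theta>" "1 = of_int 1 + of_int 0 * \<theta>" by simp_all
  then have zo: "0 \<in> {x \<in> K. algebraic_int x}" "1 \<in> {x \<in> K. algebraic_int x}"
    unfolding O_theta by blast+
  show "abelian_group (ring_of_integers K)"
  proof (rule abelian_groupI)
    fix x assume "x \<in> carrier (ring_of_integers K)"
    then show "\<exists>y\<in>carrier (ring_of_integers K). y \<oplus>\<^bsub>ring_of_integers K\<^esub> x = \<zero>\<^bsub>ring_of_integers K\<^esub>"
      using cl(3)[of x x] by (intro bexI[of _ "- x"]) auto
  qed (use cl zo in \<open>auto simp: algebra_simps\<close>)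
  show "monoid (ring_of_integers K)"
    by (rule monoidI) (use cl zo in \<open>auto simp: algebra_simps\<close>)
qed (auto simp: algebra_simps)

definition form_ideal :: "real set" where
  "form_ideal = {of_int (a * x) + of_int y * \<theta> | x y. True}"

lemma form_ideal: "ideal form_ideal (ring_of_integers K)"
proof -
  interpret R: ring "ring_of_integers K" by (rule ring_of_integers)
  have sub: "form_ideal \<subseteq> {x \<in> K. algebraic_int x}" unfolding O_theta form_ideal_def by blast
  have mult: "z * w \<in> form_ideal" if zw: "z \<in> form_ideal" "w \<in> {x \<in> K. algebraic_int x}" for z w
  proof -
    obtain x y m n where e: "z = of_int (a * x) + of_int y * \<theta>" "w = of_int m + of_int n * \<theta>"
      using zw unfolding O_theta form_ideal_def by blast
    have "z * w = of_int (a * (x * m - y * n * c)) + of_int (a * x * n + y * m + y * n * b) * \<theta>"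
      unfolding e theta_mult by (simp add: algebra_simps)
    then show ?thesis unfolding form_ideal_def by blast
  qed
  have minus: "inv\<^bsub>add_monoid (ring_of_integers K)\<^esub> x = - x" if "x \<in> form_ideal" for x
  proof -
    have "x \<in> {x \<in> K. algebraic_int x}" using sub that by blast
    moreover have "x * of_int (- 1) \<in> {x \<in> K. algebraic_int x}"
    proof -
      have "of_int (- 1) = of_int (- 1) + of_int 0 * \<theta>" by simp
      then have "of_int (- 1) \<in> {x \<in> K. algebraic_int x}" unfolding O_theta by blast
      then show ?thesis using mult[OF that] sub by blast
    qed
    ultimately have "\<ominus>\<^bsub>ring_of_integers K\<^esub> x = - x" by (intro R.minus_equality) auto
    then show ?thesis by (simp add: a_inv_def)
  qed
  show ?thesis
  proof (rule idealI[OF ring_of_integers])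
    show "subgroup form_ideal (add_monoid (ring_of_integers K))"
    proof
      show "form_ideal \<subseteq> carrier (add_monoid (ring_of_integers K))" using sub by simp
      show "z \<otimes>\<^bsub>add_monoid (ring_of_integers K)\<^esub> w \<in> form_ideal" if zw: "z \<in> form_ideal" "w \<in> form_ideal" for z w
      proof -
        obtain x y x' y' where e: "z = of_int (a * x) + of_int y * \<theta>" "w = of_int (a * x') + of_int y' * \<theta>"
          using zw unfolding form_ideal_def by blast
        have "z + w = of_int (a * (x + x')) + of_int (y + y') * \<theta>" by (simp add: e algebra_simps)
        then have "z + w \<in> form_ideal" unfolding form_ideal_def by blast
        then show ?thesis by simp
      qed
      have "0 = of_int (a * 0) + of_int 0 * \<theta>" by simp
      then have "0 \<in> form_ideal" unfolding form_ideal_def by blast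
      then show "\<one>\<^bsub>add_monoid (ring_of_integers K)\<^esub> \<in> form_ideal" by simp
      show "inv\<^bsub>add_monoid (ring_of_integers K)\<^esub> z \<in> form_ideal" if z: "z \<in> form_ideal" for z
      proof -
        obtain x y where e: "z = of_int (a * x) + of_int y * \<theta>" using z unfolding form_ideal_def by blast
        have "- z = of_int (a * (- x)) + of_int (- y) * \<theta>" by (simp add: e)
        then show ?thesis unfolding minus[OF z] form_ideal_def by blast
      qed
    qed
  qed (use mult in \<open>auto simp: mult.commute\<close>)
qed

lemma class_number_one_represents_unit:
  assumes "class_number K = 1"
  obtains x y where "a * x\<^sup>2 + b * x * y + c * y\<^sup>2 = 1 \<or> a * x\<^sup>2 + b * x * y + c * y\<^sup>2 = - 1"
proof -
  interpret R: ring "ring_of_integers K" by (rule ring_of_integers)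
  let ?O = "{x \<in> K. algebraic_int x}"
  have one: "1 \<in> ?O" using R.one_closed by simp
  have O: "?O \<in> nonzero_ideals K"
  proof -
    have "?O \<noteq> {0}" using one by (metis singletonD zero_neq_one)
    then show ?thesis using R.oneideal by (simp add: nonzero_ideals_def)
  qed
  have th: "\<theta> \<in> form_ideal" "\<theta> \<noteq> 0"
  proof -
    have "\<theta> = of_int (a * 0) + of_int 1 * \<theta>" by simp
    then show "\<theta> \<in> form_ideal" unfolding form_ideal_def by blast
    show "\<theta> \<noteq> 0" using theta_unique[of 0 1 0 0] by auto
  qed
  then have I: "form_ideal \<in> nonzero_ideals K"
    using form_ideal by (auto simp: nonzero_ideals_def)
  have refl: "(?O, ?O) \<in> ideal_equiv K"
    unfolding ideal_equiv_def using O one by (auto intro!: bexI[of _ 1])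
  obtain C where C: "nonzero_ideals K // ideal_equiv K = {C}"
    using assms by (auto simp: class_number_def card_1_singleton_iff)
  have "ideal_equiv K `` {?O} = C" "ideal_equiv K `` {form_ideal} = C"
    using quotientI[OF O, of "ideal_equiv K"] quotientI[OF I, of "ideal_equiv K"] unfolding C by auto
  then have "(form_ideal, ?O) \<in> ideal_equiv K" using refl by blast
  then obtain x y where xy: "x \<noteq> 0" "(\<lambda>z. x * z) ` form_ideal = (\<lambda>z. y * z) ` ?O"
    by (auto simp: ideal_equiv_def)
  have "y * 1 \<in> (\<lambda>z. x * z) ` form_ideal" unfolding xy(2) using one by blast
  then obtain l where l: "l \<in> form_ideal" "y = x * l" by auto
  then obtain x0 y0 where XY: "l = of_int (a * x0) + of_int y0 * \<theta>" unfolding form_ideal_def by blast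
  have gen: "\<exists>m n. z = l * (of_int m + of_int n * \<theta>)" if "z \<in> form_ideal" for z
  proof -
    have "x * z \<in> (\<lambda>z. y * z) ` ?O" using that xy(2) by blast
    then obtain w where "w \<in> ?O" "x * z = y * w" by blast
    then show ?thesis using l(2) xy(1) unfolding O_theta by auto
  qed
  have coords: "\<exists>m n. x' = m * x0 - n * (c * y0) \<and> y' = m * y0 + n * (a * x0 + b * y0)" if "a \<noteq> 0" for x' y'
  proof -
    have "of_int (a * x') + of_int y' * \<theta> \<in> form_ideal" unfolding form_ideal_def by blast
    then obtain m n where "of_int (a * x') + of_int y' * \<theta> = l * (of_int m + of_int n * \<theta>)" using gen by blast
    then have "a * x' = a * x0 * m - y0 * n * (a * c) \<and> y' = a * x0 * n + y0 * m + y0 * n * b"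
      unfolding XY theta_mult using theta_unique by blast
    then have "a * x' = a * (m * x0 - n * (c * y0)) \<and> y' = m * y0 + n * (a * x0 + b * y0)"
      by (simp add: algebra_simps)
    then show ?thesis using that by auto
  qed
  obtain m n where 1: "1 = m * x0 - n * (c * y0)" "0 = m * y0 + n * (a * x0 + b * y0)" using coords[OF leading_coeff_nonzero, of 1 0] by auto
  obtain m' n' where 2: "0 = m' * x0 - n' * (c * y0)" "1 = m' * y0 + n' * (a * x0 + b * y0)" using coords[OF leading_coeff_nonzero, of 0 1] by auto
  have "(m * n' - n * m') * (a * x0\<^sup>2 + b * x0 * y0 + c * y0\<^sup>2) =
      (m * x0 - n * (c * y0)) * (m' * y0 + n' * (a * x0 + b * y0)) - (m' * x0 - n' * (c * y0)) * (m * y0 + n * (a * x0 + b * y0))"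
    by (simp add: algebra_simps power2_eq_square)
  also have "\<dots> = 1" unfolding 1[symmetric] 2[symmetric] by simp
  finally have "a * x0\<^sup>2 + b * x0 * y0 + c * y0\<^sup>2 = 1 \<or> a * x0\<^sup>2 + b * x0 * y0 + c * y0\<^sup>2 = - 1"
    by (metis mult.commute zmult_eq_1_iff)
  then show ?thesis by (rule that)
qed

end

subsection \<open>Farey polygons\<close>

definition wedge :: "'a::comm_ring_1 \<times> 'a \<Rightarrow> 'a \<times> 'a \<Rightarrow> 'a" where
  "wedge x y = fst y * snd x - fst x * snd y"

locale farey_chain =
  fixes n :: nat and a b :: "nat \<Rightarrow> int"
  assumes n_pos: "0 < n"
    and b_pos: "i \<le> n \<Longrightarrow> 0 < b i"
    and ends: "a 0 = 0" "b 0 = 1" "a n = 1" "b n = 1"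
    and det_Suc: "i < n \<Longrightarrow> a (Suc i) * b i - a i * b (Suc i) = 1"
begin

lemma det_pos:
  assumes "i < j" "j \<le> n"
  shows "0 < a j * b i - a i * b j"
  using assms
proof (induction j)
  case (Suc j)
  show ?case
  proof (cases "i = j")
    case True
    then show ?thesis using det_Suc[of j] Suc.prems by simp
  next
    case False
    then have "0 < a j * b i - a i * b j" using Suc by simp
    moreover have d: "a (Suc j) * b j - a j * b (Suc j) = 1" using Suc.prems det_Suc by simp
    moreover have p: "0 < b i" "0 < b j" "0 < b (Suc j)" using Suc.prems b_pos by auto
    ultimately have "0 < (a j * b i - a i * b j) * b (Suc j) + b i"
      by (simp add: add_pos_pos)
    also have "\<dots> = (a (Suc j) * b i - a i * b (Suc j)) * b j"
      using d by Groebner_Basis.algebra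
    finally show ?thesis using p by (simp add: zero_less_mult_iff)
  qed
qed simp

lemma det_nonneg: "i \<le> j \<Longrightarrow> j \<le> n \<Longrightarrow> 0 \<le> a j * b i - a i * b j"
  using det_pos[of i j] by (cases "i = j") auto

lemma a_bounds:
  assumes "i \<le> n"
  shows "0 \<le> a i" "a i \<le> b i"
  using det_nonneg[of 0 i] det_nonneg[of i n] ends assms by auto

lemma fraction_inj:
  assumes "i \<le> n" "j \<le> n" "a i = a j" "b i = b j"
  shows "i = j"
  using det_pos[of i j] det_pos[of j i] assms by (metis less_irrefl linorder_neqE_nat diff_self)

lemma mediant:
  assumes "Suc i < j" "j \<le> n" and dij: "a j * b i - a i * b j = 1"
  obtains k where "i < k" "k < j" "a k = a i + a j" "b k = b i + b j"
proof -
  define x where "x t = a j * b t - a t * b j" for t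
  define y where "y t = a t * b i - a i * b t" for t
  have exp: "a t = x t * a i + y t * a j" "b t = x t * b i + y t * b j" for t
    using dij unfolding x_def y_def by Groebner_Basis.algebra+
  have y_pos: "0 < y t" if "i < t" "t \<le> j" for t
    using det_pos[of i t] that assms by (simp add: y_def)
  have x_nonneg: "0 \<le> x t" if "t \<le> j" for t
    using det_nonneg[of t j] that assms by (simp add: x_def)
  define k where "k = (LEAST t. i < t \<and> x t \<le> y t)"
  have j: "i < j \<and> x j \<le> y j" using assms y_pos[of j] by (simp add: x_def)
  have k: "i < k" "x k \<le> y k" using LeastI[of "\<lambda>t. i < t \<and> x t \<le> y t", OF j] by (auto simp: k_def)
  have kj: "k \<le> j" unfolding k_def using j by (rule Least_le)
  obtain l where l: "k = Suc l" using k by (cases k) auto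
  have il: "i \<le> l" using k l by simp
  have xl: "y l < x l"
  proof (cases "i = l")
    case True
    then show ?thesis using dij by (simp add: x_def y_def)
  next
    case False
    then have "\<not> (i < l \<and> x l \<le> y l)"
      using not_less_Least[of l "\<lambda>t. i < t \<and> x t \<le> y t"] l by (simp add: k_def)
    then show ?thesis using False il by simp
  qed
  have yl: "0 \<le> y l" using y_pos[of l] il kj l dij by (cases "i = l") (auto simp: y_def)
  have d: "x l * y k - y l * x k = 1"
  proof -
    have "a k * b l - a l * b k = 1" using det_Suc[of l] l kj assms by simp
    moreover have "a k * b l - a l * b k = (x l * y k - y l * x k) * (a j * b i - a i * b j)"
      unfolding exp[of k] exp[of l] by Groebner_Basis.algebra
    ultimately show ?thesis using dij by simp
  qed
  have yk: "0 < y k" using y_pos k kj by simp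
  have xk: "0 \<le> x k" using x_nonneg kj by simp
  have "(x l - y l - 1) * y k + y l * (y k - x k) + y k = 1" using d by (simp add: algebra_simps)
  moreover have "0 \<le> (x l - y l - 1) * y k" "0 \<le> y l * (y k - x k)"
    using xl yk yl k by auto
  ultimately have yk1: "y k = 1" using yk by linarith
  have "x k \<noteq> 0"
  proof
    assume "x k = 0"
    then have "k = j" using det_pos[of k j] kj assms by (cases "k = j") (auto simp: x_def)
    have "x l = 1" using d yk1 \<open>x k = 0\<close> by simp
    then have "y l = 0" using xl yl by simp
    then have "i = l" using y_pos[of l] il kj l by (cases "i = l") auto
    then show False using \<open>k = j\<close> l assms by simp
  qed
  then have "x k = 1" using xk k yk1 by simp
  then have "a k = a i + a j" "b k = b i + b j" using exp[of k] yk1 by auto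
  moreover have "k < j"
    using \<open>x k = 1\<close> kj by (cases "k = j") (auto simp: x_def)
  ultimately show ?thesis using that k by blast
qed

text \<open>The edges of the Farey tessellation inside the polygon with vertices \<open>a i / b i\<close>, other than
  the sides through infinity.\<close>

inductive edge :: "nat \<Rightarrow> nat \<Rightarrow> bool" where
  root: "edge 0 n"
| left: "edge i j \<Longrightarrow> i < k \<Longrightarrow> k < j \<Longrightarrow> a k = a i + a j \<Longrightarrow> b k = b i + b j \<Longrightarrow> edge i k"
| right: "edge i j \<Longrightarrow> i < k \<Longrightarrow> k < j \<Longrightarrow> a k = a i + a j \<Longrightarrow> b k = b i + b j \<Longrightarrow> edge k j"

lemma edgeD:
  assumes "edge i j"
  shows "i < j" "j \<le> n" "a j * b i - a i * b j = 1"
  using assms by (induction) (auto simp: ends n_pos algebra_simps)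

lemma edge_Suc:
  assumes "edge i j" "i \<le> t" "t < j"
  shows "edge t (Suc t)"
  using assms
proof (induction "j - i" arbitrary: i j rule: less_induct)
  case less
  show ?case
  proof (cases "j = Suc i")
    case True
    then show ?thesis using less.prems by (simp add: le_less_Suc_eq)
  next
    case False
    then have "Suc i < j" using edgeD(1)[OF less.prems(1)] by simp
    then obtain k where k: "i < k" "k < j" "a k = a i + a j" "b k = b i + b j"
      using mediant edgeD less.prems(1) by metis
    show ?thesis
    proof (cases "t < k")
      case True
      then show ?thesis using less.hyps[of k i] left[OF less.prems(1) k] k less.prems by auto
    next
      case False
      then show ?thesis using less.hyps[of j k] right[OF less.prems(1) k] k less.prems by auto
    qed
  qed
qed

definition inner_edges :: "(nat \<times> nat) set" where
  "inner_edges = {(i, j). edge i j \<and> Suc i < j}"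

lemma parents_unique:
  assumes "edge i j" "edge i' j'" "k \<le> n"
    and "a k = a i + a j" "b k = b i + b j" "a k = a i' + a j'" "b k = b i' + b j'"
  shows "i = i' \<and> j = j'"
proof -
  have d: "a j * b i - a i * b j = 1" "a j' * b i' - a i' * b j' = 1" using edgeD assms by auto
  have p: "0 < b i" "0 < b j" "0 < b i'" "0 < b j'"
    using b_pos edgeD(1,2)[OF assms(1)] edgeD(1,2)[OF assms(2)] by auto
  define x where "x = b i' - b i"
  have e1: "a k * b i - a i * b k = 1" "a k * b i' - a i' * b k = 1"
    using d assms by Groebner_Basis.algebra+
  have "x = b k * ((a i' - a i) * b i - a i * x)"
    using e1 unfolding x_def by Groebner_Basis.algebra
  then have "b k dvd x" by (metis dvd_triv_left)
  moreover have "\<bar>x\<bar> < b k" using p assms by (auto simp: x_def)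
  ultimately have x0: "x = 0" by (metis dvd_imp_le_int not_less abs_of_pos p(1,2) add_pos_pos assms(5))
  then have "b i = b i'" by (simp add: x_def)
  moreover have "a i * b k = a i' * b k" using e1 calculation by (metis diff_diff_eq2 add_diff_cancel_left' diff_eq_eq)
  then have "a i = a i'" using p assms by auto
  ultimately have "b j = b j'" "a j = a j'" using assms by auto
  then show ?thesis using fraction_inj edgeD(1,2)[OF assms(1)] edgeD(1,2)[OF assms(2)]
      \<open>b i = b i'\<close> \<open>a i = a i'\<close> by (meson less_imp_le le_trans)
qed

lemma inner_edges: "finite inner_edges" "card inner_edges \<le> n - 1"
proof -
  have "\<forall>e\<in>inner_edges. \<exists>k. fst e < k \<and> k < snd e \<and> a k = a (fst e) + a (snd e) \<and> b k = b (fst e) + b (snd e)"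
    using mediant edgeD by (fastforce simp: inner_edges_def)
  then obtain f where f: "\<forall>e\<in>inner_edges. fst e < f e \<and> f e < snd e \<and>
      a (f e) = a (fst e) + a (snd e) \<and> b (f e) = b (fst e) + b (snd e)"
    by (auto simp: bchoice_iff)
  have "inj_on f inner_edges"
  proof (rule inj_onI)
    fix e e' assume e: "e \<in> inner_edges" "e' \<in> inner_edges" "f e = f e'"
    have "edge (fst e) (snd e)" "edge (fst e') (snd e')" using e by (auto simp: inner_edges_def)
    moreover have "f e \<le> n" using edgeD(2)[OF calculation(1)] f e(1) by fastforce
    ultimately show "e = e'" using parents_unique[of "fst e" "snd e" "fst e'" "snd e'" "f e"] f e
      by (metis prod_eqI)
  qed
  moreover have "f ` inner_edges \<subseteq> {1..<n}"
  proof
    fix k assume "k \<in> f ` inner_edges"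
    then obtain e where e: "e \<in> inner_edges" "k = f e" by auto
    then have "snd e \<le> n" using edgeD by (auto simp: inner_edges_def)
    then show "k \<in> {1..<n}" using f e by fastforce
  qed
  ultimately show "finite inner_edges" "card inner_edges \<le> n - 1"
    using inj_on_finite[of f inner_edges "{1..<n}"] card_inj_on_le[of f inner_edges "{1..<n}"] by auto
qed

end

locale farey_pairing = farey_chain +
  fixes p :: nat and s :: "nat \<Rightarrow> nat"
  assumes prime_p: "prime p" and p_eq: "Suc p = 3 * n"
    and s_less: "i < n \<Longrightarrow> s i < n"
    and s_neq: "i < n \<Longrightarrow> s i \<noteq> i"
    and s_s: "i < n \<Longrightarrow> s (s i) = i"
    and pairing: "i < n \<Longrightarrow> int p dvd b i * b (s i) + b (Suc i) * b (Suc (s i))"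
begin

text \<open>Second rows, up to scaling modulo \<open>p\<close>, of coset representatives for the action on the
  projective line over the field with \<open>p\<close> elements; only the class of \<open>(0, 1)\<close> is left out.\<close>

definition rows :: "(int \<times> int) set" where
  "rows = (\<lambda>i. (b i, b (Suc i))) ` {..<n} \<union> (\<lambda>(i, j). (b i, b j)) ` inner_edges
     \<union> (\<lambda>(i, j). (b j, - b i)) ` inner_edges \<union> {(1, 0)}"

lemma rows: "finite rows" "card rows \<le> p"
proof -
  show "finite rows" by (simp add: rows_def inner_edges)
  have "card rows \<le> card ((\<lambda>i. (b i, b (Suc i))) ` {..<n}) + card ((\<lambda>(i, j). (b i, b j)) ` inner_edges)
     + card ((\<lambda>(i, j). (b j, - b i)) ` inner_edges) + card {(1::int, 0::int)}"
    unfolding rows_def by (meson add_le_mono card_Un_le le_refl le_trans)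
  also have "\<dots> \<le> n + (n - 1) + (n - 1) + 1"
    using inner_edges card_image_le[of "{..<n}" "\<lambda>i. (b i, b (Suc i))"]
      card_image_le[OF inner_edges(1), of "\<lambda>(i, j). (b i, b j)"]
      card_image_le[OF inner_edges(1), of "\<lambda>(i, j). (b j, - b i)"]
    by (intro add_mono) auto
  finally show "card rows \<le> p" using p_eq n_pos by linarith
qed

lemma not_both_dvd:
  assumes "edge i j" "int p dvd b i" shows "\<not> int p dvd b j"
proof
  assume "int p dvd b j"
  then have "int p dvd a j * b i - a i * b j" using assms by simp
  then show False using edgeD[OF assms(1)] prime_p by (auto dest: prime_gt_1_nat)
qed

lemma edge_row: "edge i j \<Longrightarrow> (b i, b j) \<in> rows"
  using edgeD[of i j] unfolding rows_def inner_edges_def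
  by (cases "j = Suc i") (force simp: less_Suc_eq_le)+

lemma edge_leaf: "i < n \<Longrightarrow> edge i (Suc i)"
  using edge_Suc[OF root] by simp

lemma reversed_edge_shift:
  assumes "edge i j" "\<not> int p dvd b j"
  shows "\<exists>(z, w)\<in>rows. \<not> int p dvd z \<and> int p dvd w * b j - (b j - b i) * z"
  using assms(1)
proof cases
  case root
  have "(1, 0) \<in> rows" by (simp add: rows_def)
  then show ?thesis using root ends prime_p by (auto dest!: prime_gt_1_nat intro!: bexI[of _ "(1, 0)"])
next
  case (left j')
  have "edge j j'" using left by (blast intro: edge.right)
  then show ?thesis using edge_row[of j j'] left assms(2)
    by (auto intro!: bexI[of _ "(b j, b j')"])
next
  case (right i')
  have "(i', j) \<in> inner_edges" using right by (simp add: inner_edges_def)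
  then have "(b j, - b i') \<in> rows" unfolding rows_def by force
  then show ?thesis using right assms(2) by (auto intro!: bexI[of _ "(b j, - b i')"])
qed

lemma rows_shift:
  assumes "(y, x) \<in> rows" "\<not> int p dvd y"
  shows "\<exists>(z, w)\<in>rows. \<not> int p dvd z \<and> int p dvd w * y - (y + x) * z"
proof -
  from assms(1) consider (leaf) i where "i < n" "y = b i" "x = b (Suc i)"
    | (fwd) i j where "edge i j" "Suc i < j" "y = b i" "x = b j"
    | (rev) i j where "edge i j" "y = b j" "x = - b i" | (inf) "y = 1" "x = 0"
    unfolding rows_def inner_edges_def by auto
  then show ?thesis
  proof cases
    case leaf
    let ?t = "s i"
    have t: "edge ?t (Suc ?t)" using edge_leaf s_less leaf by simp
    have d: "int p dvd b i * b ?t + b (Suc i) * b (Suc ?t)" using pairing leaf by simp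
    have nd: "\<not> int p dvd b (Suc ?t)"
    proof
      assume h: "int p dvd b (Suc ?t)"
      then have "int p dvd b i * b ?t" using d by (simp add: dvd_add_left_iff)
      then have "int p dvd b ?t" using assms leaf prime_p by (simp add: prime_dvd_mult_iff)
      then show False using not_both_dvd[OF t] h by simp
    qed
    obtain z w where zw: "(z, w) \<in> rows" "\<not> int p dvd z"
      "int p dvd w * b (Suc ?t) - (b (Suc ?t) - b ?t) * z"
      using reversed_edge_shift[OF t nd] by blast
    have "b (Suc ?t) * (w * b i - (b i + b (Suc i)) * z) =
       b i * (w * b (Suc ?t) - (b (Suc ?t) - b ?t) * z) - (b i * b ?t + b (Suc i) * b (Suc ?t)) * z"
      by Groebner_Basis.algebra
    then have "int p dvd b (Suc ?t) * (w * b i - (b i + b (Suc i)) * z)"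
      using zw(3) d by (simp add: dvd_diff dvd_mult dvd_mult2)
    then have "int p dvd w * b i - (b i + b (Suc i)) * z"
      using nd prime_p by (simp add: prime_dvd_mult_iff)
    then show ?thesis using zw leaf by blast
  next
    case fwd
    obtain k where k: "i < k" "k < j" "a k = a i + a j" "b k = b i + b j"
      using mediant[OF fwd(2)] edgeD fwd(1) by metis
    then have "(b i, b k) \<in> rows" using edge_row edge.left fwd by blast
    then show ?thesis using k fwd assms by (auto intro!: bexI[of _ "(b i, b k)"])
  next
    case rev
    then show ?thesis using reversed_edge_shift[of i j] assms by simp
  next
    case inf
    have "(1, 1) \<in> rows" using edge_row[OF root] ends by simp
    then show ?thesis using inf assms by (auto intro!: bexI[of _ "(1, 1)"])
  qed
qed

lemma rows_cover:
  "\<exists>(z, w)\<in>rows. \<not> int p dvd z \<and> int p dvd w - int k * z"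
proof (induction k)
  case 0
  have "(1, 0) \<in> rows" by (simp add: rows_def)
  then show ?case using prime_p by (auto dest!: prime_gt_1_nat intro!: bexI[of _ "(1, 0)"])
next
  case (Suc k)
  then obtain y x where yx: "(y, x) \<in> rows" "\<not> int p dvd y" "int p dvd x - int k * y" by blast
  obtain z w where zw: "(z, w) \<in> rows" "\<not> int p dvd z" "int p dvd w * y - (y + x) * z"
    using rows_shift[OF yx(1,2)] by blast
  have "y * (w - int (Suc k) * z) = (w * y - (y + x) * z) + (x - int k * y) * z"
    by (simp add: algebra_simps)
  then have "int p dvd y * (w - int (Suc k) * z)"
    using yx zw by (simp add: dvd_add dvd_mult2)
  then show ?case using zw yx prime_p by (auto simp: prime_dvd_mult_iff intro!: bexI[of _ "(z, w)"])
qed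

text \<open>The rows represent the \<open>p\<close> affine points of the projective line, and there are at most \<open>p\<close>
  of them, so none of them can represent the point at infinity.\<close>

lemma not_dvd_b:
  assumes "i \<le> n" shows "\<not> int p dvd b i"
proof (cases "i = n")
  case True
  then show ?thesis using ends prime_p by (auto dest: prime_gt_1_nat)
next
  case False
  then have i: "i < n" using assms by simp
  show ?thesis
  proof
    assume h: "int p dvd b i"
    let ?R = "rows - {(b i, b (Suc i))}"
    have "\<forall>k. \<exists>r. r \<in> ?R \<and> \<not> int p dvd fst r \<and> int p dvd snd r - int k * fst r"
      using rows_cover h by fastforce
    then obtain f where f: "\<And>k. f k \<in> ?R" "\<And>k. \<not> int p dvd fst (f k)"
      "\<And>k. int p dvd snd (f k) - int k * fst (f k)" by metis
    have "inj_on f {..<p}"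
    proof (rule inj_onI)
      fix k l assume kl: "k \<in> {..<p}" "l \<in> {..<p}" "f k = f l"
      have "int p dvd (snd (f k) - int k * fst (f k)) - (snd (f k) - int l * fst (f k))"
        using f(3)[of k] f(3)[of l] kl by (metis dvd_diff)
      then have "int p dvd (int l - int k) * fst (f k)" by (simp add: algebra_simps)
      then have "int p dvd int l - int k" using f(2)[of k] prime_p by (simp add: prime_dvd_mult_iff)
      then show "k = l" using kl by (auto simp: mod_eq_dvd_iff[symmetric] simp flip: of_nat_mod)
    qed
    then have "p \<le> card ?R"
      using card_inj_on_le[of f "{..<p}" ?R] f(1) rows(1) by (simp add: image_subset_iff)
    moreover have "(b i, b (Suc i)) \<in> rows" using edge_row edge_leaf i by simp
    then have "card ?R < card rows" by (rule card_Diff1_less[OF rows(1)])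
    ultimately show False using rows by simp
  qed
qed

end


subsection \<open>Ping-pong for the side pairings\<close>

definition act :: "int^2^2 \<Rightarrow> 'a::comm_ring_1 \<times> 'a \<Rightarrow> 'a \<times> 'a" where
  "act A z = (of_int (A $ 1 $ 1) * fst z + of_int (A $ 1 $ 2) * snd z,
              of_int (A $ 2 $ 1) * fst z + of_int (A $ 2 $ 2) * snd z)"

lemma mat2_nth [simp]:
  fixes x y z w :: "'a::zero"
  shows "mat2 x y z w $ 1 $ 1 = x" "mat2 x y z w $ 1 $ 2 = y"
    "mat2 x y z w $ 2 $ 1 = z" "mat2 x y z w $ 2 $ 2 = w"
  by simp_all

lemma mat2_eq_iff: "(A :: 'a^2^2) = B \<longleftrightarrow> A $ 1 $ 1 = B $ 1 $ 1 \<and> A $ 1 $ 2 = B $ 1 $ 2 \<and>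
    A $ 2 $ 1 = B $ 2 $ 1 \<and> A $ 2 $ 2 = B $ 2 $ 2"
  by (auto simp: vec_eq_iff forall_2)

lemma mat_1_nth [simp]:
  "mat 1 $ (1::2) $ (1::2) = (1::'a::zero_neq_one)" "mat 1 $ (1::2) $ (2::2) = (0::'a::zero_neq_one)"
  "mat 1 $ (2::2) $ (1::2) = (0::'a::zero_neq_one)" "mat 1 $ (2::2) $ (2::2) = (1::'a::zero_neq_one)"
  by (simp_all add: mat_def)

lemma matrix_mult_nth2:
  fixes A B :: "'a::semiring_1^2^2"
  shows "(A ** B) $ i $ j = A $ i $ 1 * B $ 1 $ j + A $ i $ 2 * B $ 2 $ j"
  by (simp add: matrix_matrix_mult_def sum_2)

lemma det_uminus2 [simp]: "det (- A :: 'a::comm_ring_1^2^2) = det A"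
  by (simp add: det_2)

lemma matrix_mult_uminus2:
  fixes A B :: "'a::comm_ring_1^2^2"
  shows "- A ** B = - (A ** B)" "A ** - B = - (A ** B)"
  by (simp_all add: mat2_eq_iff matrix_mult_nth2)

lemma act_mult: "act (A ** B) z = act A (act B z)"
  by (simp add: act_def matrix_mult_nth2 algebra_simps)

lemma act_one [simp]: "act (mat 1) z = z"
  by (simp add: act_def)

lemma act_uminus [simp]: "act (- A) z = - act A z"
  by (simp add: act_def)

lemma act_scale: "act A (c * fst z, c * snd z) = (c * fst (act A z), c * snd (act A z))"
  by (simp add: act_def algebra_simps)

lemma wedge_act: "wedge (act A x) (act A y) = of_int (det A) * wedge x y"
  by (simp add: act_def wedge_def det_2 algebra_simps)

lemma wedge_commute: "wedge x y = - wedge y x"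
  by (simp add: wedge_def)

lemma wedge_uminus [simp]: "wedge (- x) y = - wedge x y" "wedge x (- y) = - wedge x y"
  by (simp_all add: wedge_def)

text \<open>Vectors are homogeneous coordinates on the projective line: \<open>mid z \<le> 0\<close> says that the point
  \<open>fst z / snd z\<close> lies outside the open unit interval.\<close>

definition mid :: "'a::comm_ring_1 \<times> 'a \<Rightarrow> 'a" where
  "mid z = fst z * (snd z - fst z)"

lemma mid_scale: "mid (c * fst z, c * snd z) = c\<^sup>2 * mid z"
  by (simp add: mid_def algebra_simps power2_eq_square)

lemma same_sign_product:
  fixes x y :: "'a::linordered_idom"
  assumes "0 \<le> x * y" "0 \<le> A" "0 \<le> B" "0 \<le> C" "0 \<le> D"
  shows "0 \<le> (x * A + y * B) * (x * C + y * D)"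
proof -
  have "(x * A + y * B) * (x * C + y * D) =
      x\<^sup>2 * (A * C) + (x * y) * (A * D + B * C) + y\<^sup>2 * (B * D)"
    by (simp add: algebra_simps power2_eq_square)
  then show ?thesis using assms by simp
qed

lemma abs_same_sign:
  fixes x y :: "'a::linordered_idom"
  assumes "0 \<le> x * y" "0 \<le> A" "0 \<le> B"
  shows "\<bar>x * A + y * B\<bar> = \<bar>x\<bar> * A + \<bar>y\<bar> * B"
proof (cases "0 \<le> x \<and> 0 \<le> y")
  case True
  then show ?thesis using assms by simp
next
  case False
  then have "x \<le> 0" "y \<le> 0" using assms by (auto simp: zero_le_mult_iff)
  then have "x * A + y * B \<le> 0" using assms by (simp add: mult_nonpos_nonneg add_nonpos_nonpos)
  then show ?thesis using \<open>x \<le> 0\<close> \<open>y \<le> 0\<close> by simp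
qed

lemma separation_sign:
  fixes y y' e e' :: "'a::linordered_idom \<times> 'a"
  assumes "0 < mid y" "0 < mid y'" "mid e \<le> 0" "mid e' \<le> 0"
  shows "0 \<le> wedge y e * wedge y' e * (wedge y e' * wedge y' e')"
proof -
  define k where "k = (snd y - fst y) * (snd y' - fst y')"
  have k: "k \<noteq> 0" using assms by (auto simp: k_def mid_def)
  have *: "0 \<le> wedge y x * wedge y' x * k" if "mid x \<le> 0" for x
  proof -
    define u v where "u = fst x" and "v = fst x - snd x"
    define A B C D where "A = snd y - fst y" and "B = fst y" and "C = snd y' - fst y'" and "D = fst y'"
    have uv: "0 \<le> u * v" using that by (simp add: mid_def u_def v_def algebra_simps)
    have AB: "0 < A * B" "0 < C * D" using assms by (simp_all add: A_def B_def C_def D_def mid_def mult.commute)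
    have "wedge y x = u * A + v * B" "wedge y' x = u * C + v * D"
      by (simp_all add: wedge_def A_def B_def C_def D_def u_def v_def algebra_simps)
    then have "wedge y x * wedge y' x * k = (u * A + v * B) * (u * C + v * D) * (A * C)"
      by (simp add: k_def A_def C_def)
    also have "\<dots> = u\<^sup>2 * (A\<^sup>2 * C\<^sup>2) + u * v * (A\<^sup>2 * (C * D) + A * B * C\<^sup>2) + v\<^sup>2 * (A * B * (C * D))"
      by (simp add: algebra_simps power2_eq_square)
    also have "\<dots> \<ge> 0"
      by (intro add_nonneg_nonneg mult_nonneg_nonneg[OF zero_le_power2] mult_nonneg_nonneg[OF uv]
          mult_nonneg_nonneg[OF less_imp_le[OF AB(1)]] less_imp_le[OF AB(2)] zero_le_power2)
    finally show ?thesis .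
  qed
  have "0 \<le> (wedge y e * wedge y' e * k) * (wedge y e' * wedge y' e' * k)"
    using *[OF assms(3)] *[OF assms(4)] by simp
  also have "\<dots> = (wedge y e * wedge y' e * (wedge y e' * wedge y' e')) * k\<^sup>2"
    by (simp add: power2_eq_square algebra_simps)
  finally show ?thesis using k by (meson mult_neg_pos not_le zero_less_power2)
qed

lemma mid_neighbour:
  fixes x y :: "int \<times> int"
  assumes "\<bar>wedge x y\<bar> = 1" "mid x \<le> 0" "\<bar>snd x\<bar> \<noteq> 1"
  shows "mid y \<le> 0"
proof (rule ccontr)
  assume "\<not> mid y \<le> 0"
  then have AB: "0 < fst y * (snd y - fst y)" by (simp add: mid_def)
  have xy: "0 \<le> fst x * (fst x - snd x)" using assms(2) by (simp add: mid_def algebra_simps)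
  have w: "wedge x y = - (fst x * (snd y - fst y) + (fst x - snd x) * fst y)"
    by (simp add: wedge_def algebra_simps)
  have "fst y \<noteq> 0" "snd y - fst y \<noteq> 0" using AB by auto
  then have "\<bar>fst y\<bar> \<ge> 1" "\<bar>snd y - fst y\<bar> \<ge> 1" by linarith+
  have "\<bar>wedge x y\<bar> = \<bar>snd y - fst y\<bar> * \<bar>fst x\<bar> + \<bar>fst y\<bar> * \<bar>fst x - snd x\<bar>"
  proof (cases "0 < fst y")
    case True
    then have "0 < snd y - fst y" using AB by (simp add: zero_less_mult_iff)
    then show ?thesis using abs_same_sign[OF xy, of "snd y - fst y" "fst y"] True
      unfolding w abs_minus_cancel by (simp only: mult.commute abs_of_pos)
  next
    case False
    then have neg: "fst y < 0" "snd y - fst y < 0" using AB by (auto simp: zero_less_mult_iff)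
    have "wedge x y = fst x * - (snd y - fst y) + (fst x - snd x) * - fst y"
      unfolding w by (simp add: algebra_simps)
    then show ?thesis using abs_same_sign[OF xy, of "- (snd y - fst y)" "- fst y"] neg
      by (simp only: mult.commute abs_of_neg neg_0_le_iff_le less_imp_le)
  qed
  also have "\<dots> \<ge> 1 * \<bar>fst x\<bar> + 1 * \<bar>fst x - snd x\<bar>"
    using \<open>\<bar>fst y\<bar> \<ge> 1\<close> \<open>\<bar>snd y - fst y\<bar> \<ge> 1\<close> by (intro add_mono mult_right_mono) auto
  finally have le: "\<bar>fst x\<bar> + \<bar>fst x - snd x\<bar> \<le> 1" using assms by simp
  moreover have "fst x \<noteq> 0 \<or> fst x - snd x \<noteq> 0" using assms(1) by (auto simp: w)
  moreover have "fst x = 0 \<or> fst x - snd x = 0" using le by linarith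
  ultimately show False using assms(3) by linarith
qed

definition int_vec :: "int \<times> int \<Rightarrow> 'a::comm_ring_1 \<times> 'a" where
  "int_vec x = (of_int (fst x), of_int (snd x))"

lemma act_int_vec: "act A (int_vec x) = int_vec (act A x)"
  by (simp add: act_def int_vec_def)

lemma mid_int_vec: "mid (int_vec x) = of_int (mid x)"
  by (simp add: mid_def int_vec_def)

context farey_chain
begin

definition vtx :: "nat \<Rightarrow> 'a::linordered_idom \<times> 'a" where
  "vtx i = (of_int (a i), of_int (b i))"

definition side :: "nat \<Rightarrow> 'a::linordered_idom \<times> 'a \<Rightarrow> 'a" where
  "side i z = wedge (vtx i) z * wedge z (vtx (Suc i))"

lemma wedge_vtx: "wedge (vtx i) (vtx j :: 'a::linordered_idom \<times> 'a) = of_int (a j * b i - a i * b j)"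
  by (simp add: vtx_def wedge_def)

lemma wedge_vtx_Suc: "i < n \<Longrightarrow> wedge (vtx i) (vtx (Suc i)) = 1"
  using det_Suc by (simp add: wedge_vtx)

lemma wedge_vtx_nonneg: "i \<le> j \<Longrightarrow> j \<le> n \<Longrightarrow> 0 \<le> wedge (vtx i) (vtx j)"
  using det_nonneg by (simp add: wedge_vtx del: of_int_diff of_int_mult)

lemma wedge_vtx_ge1:
  assumes "i < j" "j \<le> n" shows "1 \<le> wedge (vtx i) (vtx j :: int \<times> int)"
  using det_pos[OF assms] by (simp add: wedge_vtx)

lemma wedge_expand:
  assumes "k < n"
  shows "wedge y z = wedge z (vtx (Suc k)) * wedge y (vtx k) + wedge (vtx k) z * wedge y (vtx (Suc k))"
proof -
  have "wedge z (vtx (Suc k)) * wedge y (vtx k) + wedge (vtx k) z * wedge y (vtx (Suc k))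
      = wedge y z * wedge (vtx k) (vtx (Suc k))"
    by (simp add: wedge_def algebra_simps)
  then show ?thesis by (simp only: wedge_vtx_Suc[OF assms] mult_1_right)
qed

lemma side_disjoint:
  fixes z :: "'a::linordered_idom \<times> 'a"
  assumes "i < n" "k < n" "i \<noteq> k" "0 \<le> side k z"
  shows "side i z \<le> 0"
proof -
  define x y where "x = wedge z (vtx (Suc k))" and "y = wedge (vtx k) z"
  have xy: "0 \<le> x * y" using assms by (simp add: side_def x_def y_def mult.commute)
  have e: "wedge v z = x * wedge v (vtx k) + y * wedge v (vtx (Suc k))" for v
    unfolding x_def y_def by (rule wedge_expand[OF assms(2)])
  have s: "side i z = - (wedge (vtx i) z * wedge (vtx (Suc i)) z)"
    unfolding side_def using wedge_commute[of z] by simp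
  consider "i < k" | "k < i" using assms by linarith
  then show ?thesis
  proof cases
    case 1
    then have "0 \<le> wedge (vtx i) z * wedge (vtx (Suc i)) z"
      unfolding e using assms by (intro same_sign_product[OF xy] wedge_vtx_nonneg) auto
    then show ?thesis by (simp add: s)
  next
    case 2
    have e': "wedge v z = - (x * wedge (vtx k) v + y * wedge (vtx (Suc k)) v)" for v
      unfolding e using wedge_commute[of v] by simp
    have "0 \<le> wedge (vtx i) z * wedge (vtx (Suc i)) z"
      unfolding e' minus_mult_minus using assms 2
      by (intro same_sign_product[OF xy] wedge_vtx_nonneg) auto
    then show ?thesis by (simp add: s)
  qed
qed

lemma side_outside:
  fixes z :: "'a::linordered_idom \<times> 'a"
  assumes "i < n" "mid z \<le> 0"
  shows "side i z \<le> 0"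
proof -
  have xy: "0 \<le> fst z * (fst z - snd z)" using assms by (simp add: mid_def algebra_simps)
  have e: "wedge (vtx j) z = fst z * of_int (b j - a j) + (fst z - snd z) * of_int (a j)" for j
    by (simp add: wedge_def vtx_def algebra_simps)
  have s: "side i z = - (wedge (vtx i) z * wedge (vtx (Suc i)) z)"
    unfolding side_def using wedge_commute[of z] by simp
  have pos: "0 \<le> (of_int (b j - a j) :: 'a)" "0 \<le> (of_int (a j) :: 'a)" if "j \<le> n" for j
    using a_bounds[OF that] by (simp_all del: of_int_diff)
  have "0 \<le> wedge (vtx i) z * wedge (vtx (Suc i)) z"
    unfolding e by (intro same_sign_product[OF xy] pos) (use assms in auto)
  then show ?thesis by (simp add: s)
qed

lemma mid_side:
  fixes z :: "'a::linordered_idom \<times> 'a"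
  assumes "k < n" "0 \<le> side k z"
  shows "0 \<le> mid z"
proof -
  define x y where "x = wedge z (vtx (Suc k))" and "y = wedge (vtx k) z"
  have xy: "0 \<le> x * y" using assms by (simp add: side_def x_def y_def mult.commute)
  have 1: "fst z = x * of_int (a k) + y * of_int (a (Suc k))"
    using wedge_expand[OF assms(1), of "(0, -1)" z] by (simp add: x_def y_def wedge_def vtx_def)
  have 2: "snd z - fst z = x * of_int (b k - a k) + y * of_int (b (Suc k) - a (Suc k))"
    using wedge_expand[OF assms(1), of "(-1, -1)" z] by (simp add: x_def y_def wedge_def vtx_def)
  have pos: "0 \<le> (of_int (b j - a j) :: 'a)" "0 \<le> (of_int (a j) :: 'a)" if "j \<le> n" for j
    using a_bounds[OF that] by (simp_all del: of_int_diff)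
  show ?thesis unfolding mid_def 2 unfolding 1
    by (intro same_sign_product[OF xy] pos) (use assms in auto)
qed

lemma side_exists:
  fixes z :: "'a::linordered_idom \<times> 'a"
  assumes "0 < mid z"
  obtains i where "i < n" "0 \<le> side i z" "wedge (vtx (Suc i)) z \<noteq> 0"
proof -
  have *: "\<exists>i<n. 0 \<le> side i y \<and> wedge (vtx (Suc i)) y \<noteq> 0" if "0 < fst y" "fst y < snd y" for y :: "'a \<times> 'a"
  proof -
    have n: "wedge (vtx n) y < 0" and 0: "\<not> wedge (vtx 0) y < 0"
      using that ends by (auto simp: wedge_def vtx_def)
    obtain i where i: "i < n" "\<not> wedge (vtx i) y < 0" "wedge (vtx (Suc i)) y < 0"
      using ex_least_nat_less[of "\<lambda>i. wedge (vtx i) y < 0" n] n 0 by (metis less_Suc_eq_le order_refl)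
    then have "0 \<le> side i y" unfolding side_def using wedge_commute[of y "vtx (Suc i)"]
      by (auto simp: mult_le_0_iff not_less)
    then show ?thesis using i by auto
  qed
  consider "0 < fst z" "fst z < snd z" | "0 < fst (- z)" "fst (- z) < snd (- z)"
    using assms by (auto simp: mid_def zero_less_mult_iff)
  then show ?thesis
  proof cases
    case 1
    then show ?thesis using *[of z] that by blast
  next
    case 2
    then show ?thesis using *[of "- z"] that by (auto simp: side_def)
  qed
qed

lemma measure_decreases:
  fixes z :: "int \<times> int"
  assumes "k < n" "j < n" "k \<noteq> j" "0 < side k z"
  shows "\<bar>wedge (vtx k) z\<bar> + \<bar>wedge z (vtx (Suc k))\<bar> < \<bar>wedge (vtx j) z\<bar> + \<bar>wedge z (vtx (Suc j))\<bar>"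
proof -
  define x y where "x = wedge z (vtx (Suc k))" and "y = wedge (vtx k) z"
  have xy: "0 < x * y" using assms by (simp add: side_def x_def y_def mult.commute)
  then have pos: "0 < \<bar>x\<bar>" "0 < \<bar>y\<bar>" by auto
  have e: "wedge v z = x * wedge v (vtx k) + y * wedge v (vtx (Suc k))" for v
    unfolding x_def y_def by (rule wedge_expand[OF assms(1)])
  have c: "\<bar>wedge z (vtx (Suc j))\<bar> = \<bar>wedge (vtx (Suc j)) z\<bar>"
    using wedge_commute[of z] by simp
  consider "j < k" | "k < j" using assms by linarith
  then have "\<bar>y\<bar> + \<bar>x\<bar> < \<bar>wedge (vtx j) z\<bar> + \<bar>wedge z (vtx (Suc j))\<bar>"
  proof cases
    case 1
    let ?A = "wedge (vtx j) (vtx k) :: int" and ?B = "wedge (vtx j) (vtx (Suc k)) :: int"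
    let ?C = "wedge (vtx (Suc j)) (vtx k) :: int" and ?D = "wedge (vtx (Suc j)) (vtx (Suc k)) :: int"
    have g: "1 \<le> ?A" "1 \<le> ?B" "0 \<le> ?C" "1 \<le> ?D"
      using 1 assms by (auto intro: wedge_vtx_ge1 wedge_vtx_nonneg)
    have "\<bar>wedge (vtx j) z\<bar> = \<bar>x\<bar> * ?A + \<bar>y\<bar> * ?B"
      unfolding e[of "vtx j"] using g xy by (intro abs_same_sign) auto
    moreover have "\<bar>wedge (vtx (Suc j)) z\<bar> = \<bar>x\<bar> * ?C + \<bar>y\<bar> * ?D"
      unfolding e[of "vtx (Suc j)"] using g xy by (intro abs_same_sign) auto
    moreover note g[THEN mult_left_mono[OF _ abs_ge_zero[of x]]] g[THEN mult_left_mono[OF _ abs_ge_zero[of y]]]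
    ultimately show ?thesis using pos c unfolding mult_1_right mult_zero_right by linarith
  next
    case 2
    have e': "wedge v z = - (x * wedge (vtx k) v + y * wedge (vtx (Suc k)) v)" for v
      unfolding e using wedge_commute[of v] by simp
    let ?A = "wedge (vtx k) (vtx j) :: int" and ?B = "wedge (vtx (Suc k)) (vtx j) :: int"
    let ?C = "wedge (vtx k) (vtx (Suc j)) :: int" and ?D = "wedge (vtx (Suc k)) (vtx (Suc j)) :: int"
    have g: "1 \<le> ?A" "0 \<le> ?B" "1 \<le> ?C" "1 \<le> ?D"
      using 2 assms by (auto intro: wedge_vtx_ge1 wedge_vtx_nonneg)
    have "\<bar>wedge (vtx j) z\<bar> = \<bar>x\<bar> * ?A + \<bar>y\<bar> * ?B"
      unfolding e'[of "vtx j"] abs_minus_cancel using g xy by (intro abs_same_sign) auto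
    moreover have "\<bar>wedge (vtx (Suc j)) z\<bar> = \<bar>x\<bar> * ?C + \<bar>y\<bar> * ?D"
      unfolding e'[of "vtx (Suc j)"] abs_minus_cancel using g xy by (intro abs_same_sign) auto
    moreover note g[THEN mult_left_mono[OF _ abs_ge_zero[of x]]] g[THEN mult_left_mono[OF _ abs_ge_zero[of y]]]
    ultimately show ?thesis using pos c unfolding mult_1_right mult_zero_right by linarith
  qed
  then show ?thesis by (simp add: x_def y_def)
qed

end

context farey_pairing
begin

abbreviation g :: "nat \<Rightarrow> int^2^2" where
  "g i \<equiv> farey_matrix a b i (s i)"

lemma det_g: "i < n \<Longrightarrow> det (g i) = 1"
  using det_Suc[of i] det_Suc[of "s i"] s_less[of i]
  unfolding det_2 farey_matrix_def mat2_nth Suc_eq_plus1 by Groebner_Basis.algebra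

lemma g_inverse:
  assumes "i < n" shows "g (s i) ** g i = - mat 1"
proof -
  have "g (s i) $ 1 $ 1 = - g i $ 2 $ 2" "g (s i) $ 2 $ 2 = - g i $ 1 $ 1"
    "g (s i) $ 1 $ 2 = g i $ 1 $ 2" "g (s i) $ 2 $ 1 = g i $ 2 $ 1"
    using s_s[OF assms] by (simp_all add: farey_matrix_def algebra_simps)
  then show ?thesis using det_g[OF assms]
    by (simp add: mat2_eq_iff matrix_mult_nth2 det_2 algebra_simps)
qed

lemma act_g_vtx:
  assumes "i < n"
  shows "act (g i) (vtx i :: 'a::linordered_idom \<times> 'a) = - vtx (Suc (s i))"
    and "act (g i) (vtx (Suc i) :: 'a \<times> 'a) = vtx (s i)"
proof -
  have d: "a (Suc i) * b i - a i * b (Suc i) = 1" using det_Suc assms by simp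
  have "g i $ 1 $ 1 * a i + g i $ 1 $ 2 * b i = - a (Suc (s i))"
    "g i $ 2 $ 1 * a i + g i $ 2 $ 2 * b i = - b (Suc (s i))"
    "g i $ 1 $ 1 * a (Suc i) + g i $ 1 $ 2 * b (Suc i) = a (s i)"
    "g i $ 2 $ 1 * a (Suc i) + g i $ 2 $ 2 * b (Suc i) = b (s i)"
    using d unfolding farey_matrix_def mat2_nth Suc_eq_plus1 by Groebner_Basis.algebra+
  from this[THEN arg_cong[where f="of_int :: int \<Rightarrow> 'a"]]
  show "act (g i) (vtx i :: 'a \<times> 'a) = - vtx (Suc (s i))"
    and "act (g i) (vtx (Suc i) :: 'a \<times> 'a) = vtx (s i)"
    by (simp_all add: act_def vtx_def)
qed

lemma wedge_g:
  assumes "i < n"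
  shows "wedge (vtx (s i)) (act (g i) z) = - wedge z (vtx (Suc i))"
    and "wedge (act (g i) z) (vtx (Suc (s i))) = wedge (vtx i) z"
proof -
  have "wedge (vtx (s i)) (act (g i) z) = wedge (vtx (Suc i)) z"
    using wedge_act[of "g i" "vtx (Suc i)" z] act_g_vtx(2)[OF assms, where 'a='a] det_g[OF assms]
    by simp
  then show "wedge (vtx (s i)) (act (g i) z) = - wedge z (vtx (Suc i))"
    using wedge_commute[of z] by simp
  have "wedge (act (g i) z) (vtx (Suc (s i))) = - wedge z (vtx i)"
    using wedge_act[of "g i" z "vtx i"] act_g_vtx(1)[OF assms, where 'a='a] det_g[OF assms]
    by (simp add: eq_commute[of "- _"] minus_equation_iff)
  then show "wedge (act (g i) z) (vtx (Suc (s i))) = wedge (vtx i) z"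
    using wedge_commute[of z] by simp
qed

lemma side_g: "i < n \<Longrightarrow> side (s i) (act (g i) z) = - side i z"
  by (simp add: side_def wedge_g)

text \<open>The index is the interval into which the leading letter of a reduced word maps.\<close>

inductive reduced :: "nat \<Rightarrow> int^2^2 \<Rightarrow> bool" where
  letter: "i < n \<Longrightarrow> reduced (s i) (g i)"
| cons: "reduced k A \<Longrightarrow> i < n \<Longrightarrow> k \<noteq> i \<Longrightarrow> reduced (s i) (g i ** A)"

lemma reduced_less: "reduced j A \<Longrightarrow> j < n"
  by (induction rule: reduced.induct) (auto simp: s_less)

lemma det_reduced: "reduced j A \<Longrightarrow> det A = 1"
  by (induction rule: reduced.induct) (auto simp: det_g det_mul)

lemma reduced_side:
  fixes z :: "'a::linordered_idom \<times> 'a"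
  assumes "reduced j A" "mid z \<le> 0"
  shows "0 \<le> side j (act A z)"
  using assms
proof (induction rule: reduced.induct)
  case (letter i)
  then show ?case using side_outside[of i z] by (simp add: side_g)
next
  case (cons k A i)
  then have "side i (act A z) \<le> 0" using side_disjoint[of i k "act A z"] reduced_less by blast
  then show ?case using cons by (simp add: act_mult side_g)
qed

definition words :: "(int^2^2) set" where
  "words = {A. A = mat 1 \<or> A = - mat 1 \<or> (\<exists>j. reduced j A \<or> reduced j (- A))}"

lemma words_uminus: "A \<in> words \<Longrightarrow> - A \<in> words"
  by (auto simp: words_def)

lemma mat_1_words: "mat 1 \<in> words"
  by (simp add: words_def)

lemma g_words: "i < n \<Longrightarrow> g i \<in> words"
  using letter by (auto simp: words_def)

lemma det_words: "A \<in> words \<Longrightarrow> det A = 1"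
  using det_reduced[of _ A] det_reduced[of _ "- A"] by (auto simp: words_def)

lemma g_mult_reduced:
  assumes "reduced k A" "i < n"
  shows "g i ** A \<in> words"
proof (cases "k = i")
  case True
  from assms(1) show ?thesis
  proof cases
    case (letter i')
    then have "s i = i'" using True s_s by simp
    then show ?thesis using letter True g_inverse[of i'] by (simp add: words_def)
  next
    case (cons k' A' i')
    then have "s i = i'" using True s_s by simp
    then have "g i ** A = - A'"
      using cons True g_inverse[of i'] by (simp add: matrix_mul_assoc matrix_mult_uminus2)
    then show ?thesis using cons by (auto simp: words_def)
  qed
next
  case False
  then show ?thesis using cons[OF assms(1,2)] by (auto simp: words_def)
qed

lemma g_mult_words:
  assumes "A \<in> words" "i < n"
  shows "g i ** A \<in> words"
proof -
  consider "A = mat 1 \<or> A = - mat 1" | j where "reduced j A" | j where "reduced j (- A)"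
    using assms by (auto simp: words_def)
  then show ?thesis
  proof cases
    case 1
    then show ?thesis using g_words[OF assms(2)] words_uminus by (auto simp: matrix_mult_uminus2)
  next
    case 2
    then show ?thesis using g_mult_reduced assms by blast
  next
    case 3
    then have "g i ** - A \<in> words" using g_mult_reduced assms by blast
    then show ?thesis using words_uminus by (fastforce simp: matrix_mult_uminus2)
  qed
qed

lemma words_mult:
  assumes "A \<in> words" "B \<in> words"
  shows "A ** B \<in> words"
proof -
  have *: "C ** B \<in> words" if "reduced j C" for j C
    using that by (induction rule: reduced.induct)
      (auto simp: assms(2) g_mult_words simp flip: matrix_mul_assoc)
  consider "A = mat 1 \<or> A = - mat 1" | j where "reduced j A" | j where "reduced j (- A)"
    using assms by (auto simp: words_def)
  then show ?thesis
  proof cases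
    case 1
    then show ?thesis using assms words_uminus by (auto simp: matrix_mult_uminus2)
  next
    case 2
    then show ?thesis using * by blast
  next
    case 3
    then have "- A ** B \<in> words" using * by blast
    then show ?thesis using words_uminus by (fastforce simp: matrix_mult_uminus2)
  qed
qed

lemma dvd_act_g: "i < n \<Longrightarrow> int p dvd snd z \<Longrightarrow> int p dvd snd (act (g i) z)"
  using pairing[of i] by (simp add: act_def farey_matrix_def)

lemma dvd_act_words:
  assumes "A \<in> words" "int p dvd snd z"
  shows "int p dvd snd (act A z)"
proof -
  have "int p dvd snd (act C z)" if "reduced j C" for j C
    using that by (induction rule: reduced.induct) (auto simp: act_mult dvd_act_g assms(2))
  from this[of _ A] this[of _ "- A"] show ?thesis using assms by (auto simp: words_def)
qed

lemma cusp_not_vtx: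
  assumes "i \<le> n" "int p dvd snd z" "wedge z z' = (1::int)"
  shows "wedge (vtx i) z \<noteq> 0"
proof
  assume 0: "wedge (vtx i) z = 0"
  have "snd z * wedge z' (vtx i) + of_int (b i) * wedge z z' = snd z' * wedge z (vtx i)"
    by (simp add: wedge_def vtx_def algebra_simps)
  moreover have "wedge z (vtx i) = 0" using 0 wedge_commute[of z] by simp
  ultimately have "b i = - (snd z * wedge z' (vtx i))" using assms by simp
  then have "int p dvd b i" using assms by simp
  then show False using not_dvd_b assms by blast
qed

lemma cusp_descent_aux:
  assumes "i < n" "0 < side i z" "int p dvd snd z" "wedge z z' = (1::int)"
  shows "\<exists>A\<in>words. \<exists>B\<in>words. A ** B = mat 1 \<and> B ** A = mat 1 \<and> mid (act A z) \<le> 0"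
  using assms
proof (induction "nat (\<bar>wedge (vtx i) z\<bar> + \<bar>wedge z (vtx (Suc i))\<bar>)" arbitrary: i z z' rule: less_induct)
  case less
  let ?y = "act (g i) z" and ?y' = "act (g i) z'"
  have si: "s i < n" using less.prems s_less by simp
  have inv: "(- g (s i)) ** g i = mat 1" "g i ** (- g (s i)) = mat 1"
    using g_inverse[OF less.prems(1)] g_inverse[OF si] s_s[OF less.prems(1)]
    by (simp_all add: matrix_mult_uminus2)
  have w: "g i \<in> words" "- g (s i) \<in> words" using g_words less.prems si words_uminus by auto
  have y: "int p dvd snd ?y" "wedge ?y ?y' = 1"
    using dvd_act_g less.prems det_g by (auto simp: wedge_act)
  show ?case
  proof (cases "mid ?y \<le> 0")
    case True
    then show ?thesis using inv w by blast
  next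
    case False
    then obtain k where k: "k < n" "0 \<le> side k ?y" "wedge (vtx (Suc k)) ?y \<noteq> 0"
      using side_exists[of ?y] by auto
    have "side k ?y \<noteq> 0" using k cusp_not_vtx[of k ?y ?y'] y wedge_commute[of ?y "vtx (Suc k)"]
      by (auto simp: side_def)
    then have pos: "0 < side k ?y" using k by simp
    then have "k \<noteq> s i" using side_g[OF less.prems(1), of z] less.prems(2) by auto
    then have "\<bar>wedge (vtx k) ?y\<bar> + \<bar>wedge ?y (vtx (Suc k))\<bar>
        < \<bar>wedge (vtx (s i)) ?y\<bar> + \<bar>wedge ?y (vtx (Suc (s i)))\<bar>"
      using measure_decreases k si pos by blast
    then have "nat (\<bar>wedge (vtx k) ?y\<bar> + \<bar>wedge ?y (vtx (Suc k))\<bar>)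
        < nat (\<bar>wedge (vtx i) z\<bar> + \<bar>wedge z (vtx (Suc i))\<bar>)"
      by (simp add: wedge_g[OF less.prems(1)])
    then obtain A B where AB: "A \<in> words" "B \<in> words" "A ** B = mat 1" "B ** A = mat 1"
      "mid (act A ?y) \<le> 0"
      using less.hyps[of k ?y ?y'] k pos y by blast
    have "(A ** g i) ** ((- g (s i)) ** B) = A ** (g i ** (- g (s i))) ** B"
      by (simp only: matrix_mul_assoc)
    moreover have "((- g (s i)) ** B) ** (A ** g i) = (- g (s i)) ** (B ** A) ** g i"
      by (simp only: matrix_mul_assoc)
    ultimately show ?thesis
      using AB inv words_mult[OF AB(1) w(1)] words_mult[OF w(2) AB(2)]
      by (intro bexI[of _ "A ** g i"] bexI[of _ "(- g (s i)) ** B"]) (simp_all add: act_mult)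
  qed
qed

lemma cusp_descent:
  assumes "int p dvd snd z" "wedge z z' = (1::int)"
  obtains A B where "A \<in> words" "B \<in> words" "A ** B = mat 1" "B ** A = mat 1" "mid (act A z) \<le> 0"
proof (cases "mid z \<le> 0")
  case True
  then show ?thesis using that[of "mat 1" "mat 1"] mat_1_words by simp
next
  case False
  then obtain k where k: "k < n" "0 \<le> side k z" "wedge (vtx (Suc k)) z \<noteq> 0"
    using side_exists[of z] by auto
  have "side k z \<noteq> 0" using k cusp_not_vtx[of k z z'] assms wedge_commute[of z "vtx (Suc k)"]
    by (auto simp: side_def)
  then show ?thesis using cusp_descent_aux[of k z z'] k assms that by auto
qed

lemma words_axis:
  fixes z :: "real \<times> real"
  assumes N: "N \<in> words" "N \<noteq> mat 1" "N \<noteq> - mat 1"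
    and eig: "act N z = (c * fst z, c * snd z)" and "mid z \<noteq> 0"
  shows "0 < mid z"
proof (rule ccontr)
  assume "\<not> 0 < mid z"
  then have neg: "mid z < 0" using assms(5) by simp
  obtain j where j: "reduced j N \<or> reduced j (- N)" using N by (auto simp: words_def)
  have "0 \<le> side j (act N z)"
    using j reduced_side[of j N z] reduced_side[of j "- N" z] neg by (auto simp: side_def)
  then have "0 \<le> mid (act N z)" using mid_side reduced_less j by blast
  then have "0 \<le> c\<^sup>2 * mid z" by (simp add: eig mid_scale)
  then have c: "c = 0" using neg by (simp add: zero_le_mult_iff)
  have "wedge (act N z) (act N (0, 1)) = wedge z (0, 1)" "wedge (act N z) (act N (1, 0)) = wedge z (1, 0)"
    using det_words[OF N(1)] by (simp_all add: wedge_act)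
  then have "fst z = 0" "snd z = 0" by (simp_all add: eig c) (simp_all add: wedge_def)
  then show False using assms(5) by (simp add: mid_def)
qed

text \<open>Farey neighbours \<open>w\<close> and \<open>w'\<close> such that \<open>p\<close> divides the denominator of \<open>w\<close> are exactly the ends
  of the \<open>\<Gamma>\<^sub>0(p)\<close>-translates of the geodesic from \<open>0\<close> to infinity, so the conclusion says that no
  such translate crosses the axis of \<open>M\<close>.\<close>

lemma axis_not_crossing:
  fixes z z' :: "real \<times> real" and w w' :: "int \<times> int"
  assumes M: "M \<in> words" "M \<noteq> mat 1" "M \<noteq> - mat 1"
    and eig: "act M z = (c * fst z, c * snd z)" "act M z' = (c' * fst z', c' * snd z')"
    and irr: "\<And>x. x \<noteq> 0 \<Longrightarrow> wedge z (int_vec x) \<noteq> 0" "\<And>x. x \<noteq> 0 \<Longrightarrow> wedge z' (int_vec x) \<noteq> 0"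
    and w: "int p dvd snd w" "wedge w w' = 1"
  shows "0 \<le> wedge z (int_vec w) * wedge z' (int_vec w) *
    (wedge z (int_vec w') * wedge z' (int_vec w'))"
proof -
  obtain A B where AB: "A \<in> words" "B \<in> words" "A ** B = mat 1" "B ** A = mat 1" "mid (act A w) \<le> 0"
    using cusp_descent w by blast
  define N where "N = A ** M ** B"
  have BNA: "B ** N ** A = M"
  proof -
    have "B ** N ** A = (B ** A) ** M ** (B ** A)" by (simp only: N_def matrix_mul_assoc)
    then show ?thesis by (simp add: AB)
  qed
  have N: "N \<in> words" "N \<noteq> mat 1" "N \<noteq> - mat 1"
    using AB words_mult M BNA by (auto simp: N_def matrix_mult_uminus2)
  have BA: "act B (act A x) = x" for x :: "real \<times> real" using AB by (simp flip: act_mult)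
  have inside: "0 < mid (act A y)"
    if y: "act M y = (e * fst y, e * snd y)" "\<And>x. x \<noteq> 0 \<Longrightarrow> wedge y (int_vec x) \<noteq> 0" for y :: "real \<times> real" and e
  proof (rule words_axis[OF N])
    show "act N (act A y) = (e * fst (act A y), e * snd (act A y))"
      by (simp add: N_def act_mult BA y act_scale)
    have *: "wedge (act A y) (int_vec x) \<noteq> 0" if "x \<noteq> 0" for x
    proof
      assume 0: "wedge (act A y) (int_vec x) = 0"
      have "wedge (act B (act A y)) (act B (int_vec x)) = 0"
        by (simp add: wedge_act 0)
      then have "wedge y (int_vec (act B x)) = 0" by (simp add: BA act_int_vec)
      then have "act B x = 0" using y(2) by blast
      moreover have "act A (act B x) = x" using AB by (simp flip: act_mult)
      moreover have "act A 0 = (0 :: int \<times> int)" by (simp add: act_def zero_prod_def)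
      ultimately show False using that by simp
    qed
    show "mid (act A y) \<noteq> 0"
      using *[of "(0, 1)"] *[of "(1, 1)"] by (auto simp: mid_def wedge_def int_vec_def zero_prod_def)
  qed
  have "int p dvd snd (act A w)" using dvd_act_words AB(1) w(1) by blast
  then have nt: "\<bar>snd (act A w)\<bar> \<noteq> 1"
    using prime_gt_1_nat[OF prime_p] by (metis dvd_abs_iff of_nat_1 of_nat_dvd_iff nat_dvd_1_iff_1 less_irrefl)
  have det: "det A = 1" using AB(1) by (rule det_words)
  have wAw: "\<bar>wedge (act A w) (act A w')\<bar> = 1" by (simp add: wedge_act det w)
  have mid': "mid (act A w') \<le> 0" using mid_neighbour[OF wAw AB(5) nt] .
  have inv: "wedge (act A y) (int_vec (act A x)) = wedge y (int_vec x)" for y :: "real \<times> real" and x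
    by (simp add: wedge_act det flip: act_int_vec)
  have "mid (int_vec (act A w) :: real \<times> real) \<le> 0" "mid (int_vec (act A w') :: real \<times> real) \<le> 0"
    using AB(5) mid' by (simp_all add: mid_int_vec)
  from separation_sign[OF inside[OF eig(1) irr(1)] inside[OF eig(2) irr(2)] this]
  show ?thesis by (simp add: inv)
qed

end


subsection \<open>The subgroup generated by the side pairings\<close>

lemma SL2Z_simps [simp]:
  "carrier SL2Z = {A. det A = 1}" "A \<otimes>\<^bsub>SL2Z\<^esub> B = A ** B" "\<one>\<^bsub>SL2Z\<^esub> = mat 1"
  by (simp_all add: SL2Z_def)

definition adj2 :: "int^2^2 \<Rightarrow> int^2^2" where
  "adj2 A = mat2 (A $ 2 $ 2) (- A $ 1 $ 2) (- A $ 2 $ 1) (A $ 1 $ 1)"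

lemma adj2:
  assumes "det A = 1"
  shows "det (adj2 A) = 1" "adj2 A ** A = mat 1"
  using assms by (simp_all add: adj2_def mat2_eq_iff matrix_mult_nth2 det_2 algebra_simps)

lemma group_SL2Z: "group SL2Z"
proof (rule groupI)
  fix A assume "A \<in> carrier SL2Z"
  then show "\<exists>B\<in>carrier SL2Z. B \<otimes>\<^bsub>SL2Z\<^esub> A = \<one>\<^bsub>SL2Z\<^esub>"
    using adj2[of A] by (auto intro!: bexI[of _ "adj2 A"])
qed (auto simp: det_mul matrix_mul_assoc)

lemma to_PSL2Z: "to_PSL2Z A = {A, - A}"
  by (auto simp: to_PSL2Z_def r_coset_def matrix_mult_uminus2)

lemma normal_center: "{mat 1, - mat 1} \<lhd> SL2Z"
proof -
  interpret group SL2Z by (rule group_SL2Z)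
  have inv: "inv\<^bsub>SL2Z\<^esub> (- mat 1) = - mat 1"
    by (rule inv_equality) (simp_all add: matrix_mult_uminus2)
  have one: "inv\<^bsub>SL2Z\<^esub> (mat 1) = mat 1"
    by (rule inv_equality) simp_all
  have "subgroup {mat 1, - mat 1} SL2Z"
    by (rule subgroupI) (auto simp: matrix_mult_uminus2 inv one)
  then show ?thesis
    by (rule normalI) (auto simp: r_coset_def l_coset_def matrix_mult_uminus2)
qed

lemma group_PSL2Z: "group PSL2Z"
  unfolding PSL2Z_def by (rule normal.factorgroup_is_group[OF normal_center])

lemma carrier_PSL2Z: "carrier PSL2Z = to_PSL2Z ` {A. det A = 1}"
  by (simp add: PSL2Z_def carrier_FactGroup to_PSL2Z_def)

lemma to_PSL2Z_mult: "to_PSL2Z A \<otimes>\<^bsub>PSL2Z\<^esub> to_PSL2Z B = to_PSL2Z (A ** B)"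
  by (auto simp: PSL2Z_def set_mult_def to_PSL2Z matrix_mult_uminus2)

lemma to_PSL2Z_one: "\<one>\<^bsub>PSL2Z\<^esub> = to_PSL2Z (mat 1)"
  by (auto simp: PSL2Z_def to_PSL2Z)

lemma inv_to_PSL2Z:
  assumes "det A = 1" "det B = 1" "B ** A = mat 1"
  shows "inv\<^bsub>PSL2Z\<^esub> (to_PSL2Z A) = to_PSL2Z B"
  by (rule group.inv_equality[OF group_PSL2Z])
     (use assms in \<open>auto simp: to_PSL2Z_mult to_PSL2Z_one carrier_PSL2Z\<close>)

lemma subgroup_Gamma0: "subgroup (carrier (Gamma0 p)) PSL2Z"
proof -
  have carrier: "carrier (Gamma0 p) = to_PSL2Z ` {A. det A = 1 \<and> int p dvd A $ 2 $ 1}"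
    by (simp add: Gamma0_def)
  show ?thesis
  proof (rule group.subgroupI[OF group_PSL2Z])
    show "carrier (Gamma0 p) \<subseteq> carrier PSL2Z" by (auto simp: carrier carrier_PSL2Z)
    have "to_PSL2Z (mat 1) \<in> carrier (Gamma0 p)" unfolding carrier by (rule imageI) simp
    then show "carrier (Gamma0 p) \<noteq> {}" by blast
  next
    fix x assume "x \<in> carrier (Gamma0 p)"
    then obtain A where A: "x = to_PSL2Z A" "det A = 1" "int p dvd A $ 2 $ 1" by (auto simp: carrier)
    have "inv\<^bsub>PSL2Z\<^esub> x = to_PSL2Z (adj2 A)" unfolding A(1) using A adj2[of A] by (intro inv_to_PSL2Z)
    moreover have "int p dvd adj2 A $ 2 $ 1" using A by (simp add: adj2_def)
    ultimately show "inv\<^bsub>PSL2Z\<^esub> x \<in> carrier (Gamma0 p)" using A adj2[of A] by (auto simp: carrier)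
  next
    fix x y assume "x \<in> carrier (Gamma0 p)" "y \<in> carrier (Gamma0 p)"
    then obtain A B where A: "x = to_PSL2Z A" "det A = 1" "int p dvd A $ 2 $ 1"
      and B: "y = to_PSL2Z B" "det B = 1" "int p dvd B $ 2 $ 1" by (auto simp: carrier)
    have "int p dvd (A ** B) $ 2 $ 1" using A B by (simp add: matrix_mult_nth2)
    moreover have "det (A ** B) = 1" using A B by (simp add: det_mul)
    ultimately show "x \<otimes>\<^bsub>PSL2Z\<^esub> y \<in> carrier (Gamma0 p)"
      unfolding A(1) B(1) to_PSL2Z_mult by (auto simp: carrier)
  qed
qed

lemma (in farey_pairing) generate_farey_matrices:
  "generate (Gamma0 p) (farey_matrices p a b s) \<subseteq> to_PSL2Z ` words"
proof -
  have n: "(p + 1) div 3 = n" using p_eq by simp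
  have sub: "farey_matrices p a b s \<subseteq> to_PSL2Z ` g ` {..<n}"
    by (auto simp: farey_matrices_def n[simplified])
  have dvd: "int p dvd g i $ 2 $ 1" if "i < n" for i
    using pairing[OF that] by (simp add: farey_matrix_def)
  have G: "farey_matrices p a b s \<subseteq> carrier (Gamma0 p)"
  proof
    fix x assume "x \<in> farey_matrices p a b s"
    then obtain i where i: "i < n" "x = to_PSL2Z (g i)" using sub by blast
    then have "g i \<in> {A \<in> carrier SL2Z. int p dvd A $ 2 $ 1}" using dvd det_g by simp
    then show "x \<in> carrier (Gamma0 p)" unfolding i(2) Gamma0_def by simp
  qed
  have "generate (Gamma0 p) (farey_matrices p a b s) = generate PSL2Z (farey_matrices p a b s)"
    using group.generate_consistent[OF group_PSL2Z G subgroup_Gamma0] by (simp add: Gamma0_def)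
  moreover have "x \<in> to_PSL2Z ` words" if "x \<in> generate PSL2Z (farey_matrices p a b s)" for x
    using that
  proof (induction rule: generate.induct)
    case one
    then show ?case using mat_1_words by (auto simp: to_PSL2Z_one)
  next
    case (incl h)
    then show ?case using sub g_words by blast
  next
    case (inv h)
    then obtain i where i: "h = to_PSL2Z (g i)" "i < n" using sub by blast
    have "- g (s i) ** g i = mat 1" using g_inverse[OF i(2)] by (simp only: matrix_mult_uminus2 minus_minus)
    moreover have "det (- g (s i)) = 1" using det_g[OF s_less[OF i(2)]] by (simp only: det_uminus2)
    ultimately have "inv\<^bsub>PSL2Z\<^esub> h = to_PSL2Z (- g (s i))"
      unfolding i(1) using det_g[OF i(2)] by (intro inv_to_PSL2Z)
    then show ?case using g_words[OF s_less[OF i(2)]] words_uminus by blast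
  next
    case (eng h1 h2)
    then obtain A B where "h1 = to_PSL2Z A" "h2 = to_PSL2Z B" "A \<in> words" "B \<in> words" by blast
    then show ?case using words_mult to_PSL2Z_mult by blast
  qed
  ultimately show ?thesis by blast
qed

lemma farey_symbol_pairing:
  assumes "prime p" "[int p = - 1] (mod 12)" "farey_symbol p a b s"
  shows "farey_pairing ((p + 1) div 3) a b p s"
proof -
  have "int p mod 12 = 11" using assms(2) by (simp add: cong_def)
  then have n: "Suc p = 3 * ((p + 1) div 3)" by presburger
  define n where "n = (p + 1) div 3"
  have F: "\<And>i. i \<le> n \<Longrightarrow> 0 < b i" "a 0 = 0" "b 0 = 1" "a n = 1" "b n = 1"
    "\<And>i. i < n \<Longrightarrow> a (Suc i) * b i - a i * b (Suc i) = 1"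
    "\<And>i. i < n \<Longrightarrow> s i < n" "\<And>i. i < n \<Longrightarrow> s i \<noteq> i" "\<And>i. i < n \<Longrightarrow> s (s i) = i"
    "\<And>i. i < n \<Longrightarrow> [b i * b (s i) + b (Suc i) * b (Suc (s i)) = 0] (mod int p)"
    using assms(3) unfolding farey_symbol_def Let_def Suc_eq_plus1 n_def[symmetric] by blast+
  have n3: "Suc p = 3 * n" using n by (simp only: n_def)
  then have "0 < n" by linarith
  then have "farey_pairing n a b p s"
    by (intro farey_pairing.intro farey_chain.intro farey_pairing_axioms.intro F assms(1) n3
        F(10)[unfolded cong_0_iff])
  then show ?thesis by (simp only: n_def)
qed

text \<open>With \<open>w'\<close> representing a unit, \<open>w\<close> is its product with \<open>(t + \<surd>D) / 2\<close> where
  \<open>t \<equiv> - b\<close> modulo \<open>2 p\<close> and \<open>\<bar>t\<bar> \<le> p\<close>, which has negative norm.\<close>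

lemma (in quadratic_form) crossing_edge:
  fixes p :: nat
  assumes rep: "a * x\<^sup>2 + b * x * y + c * y\<^sup>2 = e" "e = 1 \<or> e = - 1"
    and p: "int p dvd a" "0 < p" "int p ^ 2 < D"
  obtains w w' :: "int \<times> int" where "int p dvd snd w" "wedge w w' = 1"
    "(a * (fst w)\<^sup>2 + b * fst w * snd w + c * (snd w)\<^sup>2) *
     (a * (fst w')\<^sup>2 + b * fst w' * snd w' + c * (snd w')\<^sup>2) < 0"
proof -
  define q where "q = (int p - b) div (2 * int p)"
  define k where "k = - b - int p * q"
  define t where "t = 2 * k + b"
  have "q * (2 * int p) + (int p - b) mod (2 * int p) = int p - b"
    unfolding q_def by (rule div_mult_mod_eq)
  moreover have "t = - b - q * (2 * int p)" by (simp add: t_def k_def)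
  ultimately have tm: "t = (int p - b) mod (2 * int p) - int p" by linarith
  have "0 \<le> (int p - b) mod (2 * int p)" "(int p - b) mod (2 * int p) < 2 * int p"
    using p(2) by simp_all
  then have "\<bar>t\<bar> \<le> int p" using tm by linarith
  then have "t\<^sup>2 \<le> (int p)\<^sup>2" by (rule power2_le_iff_abs_le[THEN iffD2, rotated]) simp
  then have tD: "t\<^sup>2 - D < 0" using p(3) by simp
  define w where "w = (k * x - c * y, a * x + (b + k) * y)"
  define w' where "w' = (e * x, e * y)"
  have ee: "e * e = 1" using rep(2) by auto
  have "b + k = int p * (- q)" by (simp add: k_def)
  then have dvd: "int p dvd snd w" using p(1) by (simp add: w_def)
  have "wedge w w' = e * (a * x\<^sup>2 + b * x * y + c * y\<^sup>2)"
    by (simp add: wedge_def w_def w'_def algebra_simps power2_eq_square)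
  then have wedge: "wedge w w' = 1" by (simp only: rep(1) ee)
  define Q where "Q v = a * (fst v)\<^sup>2 + b * fst v * snd v + c * (snd v)\<^sup>2" for v :: "int \<times> int"
  have "4 * Q w = (a * x\<^sup>2 + b * x * y + c * y\<^sup>2) * (t\<^sup>2 - D)"
    unfolding t_def disc[symmetric] by (simp add: Q_def w_def algebra_simps power2_eq_square)
  then have Qw: "4 * Q w = e * (t\<^sup>2 - D)" by (simp only: rep(1))
  have "Q w' = e * e * (a * x\<^sup>2 + b * x * y + c * y\<^sup>2)"
    by (simp add: Q_def w'_def algebra_simps power2_eq_square)
  then have Qw': "Q w' = e" by (simp only: rep(1) ee mult_1_left)
  have "4 * (Q w * Q w') = (4 * Q w) * Q w'" by simp
  also have "\<dots> = (e * e) * (t\<^sup>2 - D)" unfolding Qw Qw' by (simp only: mult_ac)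
  also have "\<dots> < 0" using tD by (simp only: ee mult_1_left)
  finally have "Q w * Q w' < 0" using mult_less_0_iff[of 4 "Q w * Q w'"] by simp
  then show ?thesis using that[OF dvd wedge] by (simp only: Q_def)
qed

context quadratic_form
begin

definition root_vec :: "real \<Rightarrow> real \<times> real" where
  "root_vec \<sigma> = (- of_int b + \<sigma>, 2 * of_int a)"

lemma wedge_root:
  "wedge (root_vec \<sigma>) (int_vec v) = of_int (2 * a * fst v + b * snd v) - \<sigma> * of_int (snd v)"
  by (simp add: wedge_def root_vec_def int_vec_def algebra_simps)

lemma wedge_roots:
  "wedge (root_vec s) (int_vec v) * wedge (root_vec (- s)) (int_vec v)
    = of_int (4 * a * (a * (fst v)\<^sup>2 + b * fst v * snd v + c * (snd v)\<^sup>2))"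
proof -
  define A where "A = 2 * a * fst v + b * snd v"
  have "wedge (root_vec s) (int_vec v) * wedge (root_vec (- s)) (int_vec v)
    = of_int A * of_int A - s * s * (of_int (snd v) * of_int (snd v))"
    unfolding wedge_root A_def[symmetric] by (simp add: algebra_simps)
  also have "\<dots> = of_int (A * A - D * (snd v * snd v))"
    unfolding s_sq by simp
  also have "A * A - D * (snd v * snd v) = 4 * a * (a * (fst v)\<^sup>2 + b * fst v * snd v + c * (snd v)\<^sup>2)"
    unfolding disc[symmetric] A_def by (simp add: algebra_simps power2_eq_square)
  finally show ?thesis .
qed

lemma root_irrational:
  assumes "v \<noteq> 0" "\<sigma> = s \<or> \<sigma> = - s"
  shows "wedge (root_vec \<sigma>) (int_vec v) \<noteq> 0"
proof
  assume "wedge (root_vec \<sigma>) (int_vec v) = 0"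
  then have e: "\<sigma> * of_int (snd v) = of_int (2 * a * fst v + b * snd v)"
    unfolding wedge_root by linarith
  have nz: "snd v \<noteq> 0"
  proof
    assume 0: "snd v = 0"
    then have "of_int (2 * a * fst v) = (0 :: real)" using e by simp
    then have "fst v = 0" using leading_coeff_nonzero by simp
    then show False using assms(1) 0 by (simp add: prod_eq_iff)
  qed
  have "\<sigma> = \<sigma> * of_int (snd v) / of_int (snd v)" using nz by simp
  also have "\<dots> \<in> \<rat>" unfolding e by (intro Rats_divide Rats_of_int)
  finally show False using assms(2) s_irr by auto
qed

lemma automorph_eigenvector:
  assumes M: "M = mat2 k (c * V) (- a * V) (k - b * V)" and "\<sigma> * \<sigma> = of_int D"
  shows "act M (root_vec \<sigma>) =
    ((2 * of_int k - of_int (b * V) - of_int V * \<sigma>) / 2 * fst (root_vec \<sigma>),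
     (2 * of_int k - of_int (b * V) - of_int V * \<sigma>) / 2 * snd (root_vec \<sigma>))"
proof -
  have "(2 * of_int k - of_int (b * V) - of_int V * \<sigma>) / 2 * (- of_int b + \<sigma>) =
      of_int k * (- of_int b + \<sigma>) + of_int V * (of_int b * of_int b - \<sigma> * \<sigma>) / 2"
    by (simp add: algebra_simps add_divide_distrib diff_divide_distrib)
  also have "of_int b * of_int b - \<sigma> * \<sigma> = 4 * of_int a * of_int c"
    unfolding assms(2) disc[symmetric] by (simp add: power2_eq_square)
  finally have e: "(2 * of_int k - of_int (b * V) - of_int V * \<sigma>) / 2 * (- of_int b + \<sigma>) =
      of_int k * (- of_int b + \<sigma>) + of_int (c * V) * (2 * of_int a)"
    by simp
  have e': "of_int (- a * V) * (- of_int b + \<sigma>) + of_int (k - b * V) * (2 * of_int a) =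
      (2 * of_int k - of_int (b * V) - of_int V * \<sigma>) / 2 * (2 * of_int a)"
    by (simp add: algebra_simps)
  show ?thesis unfolding M act_def root_vec_def mat2_nth fst_conv snd_conv e e' ..
qed

end

theorem corollary1p7:
  shows "\<forall>\<epsilon>>0::real. \<exists>C>0::real.
    \<forall>(p::nat) fa fb s (K::real set) P1 P2 u v (a::int) (b::int) (c::int).
      prime p \<longrightarrow> [int p = - 1] (mod 12) \<longrightarrow>
      farey_symbol p fa fb s \<longrightarrow>
      real_quadratic_field K \<longrightarrow> class_number K = 1 \<longrightarrow>
      splits_as K p P1 P2 \<longrightarrow>
      \<not> (\<exists>x\<in>carrier (ring_of_integers K).
            P1 = cgenideal (ring_of_integers K) x \<and> field_norm K x > 0) \<longrightarrow>
      minimal_pell_solution (field_discriminant K) u v \<longrightarrow>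
      b\<^sup>2 - 4 * a * c = field_discriminant K \<longrightarrow> int p dvd a \<longrightarrow>
      real_of_int (field_discriminant K) \<ge> C * real p powr (24 + \<epsilon>) \<longrightarrow>
      (\<exists>M::int^2^2.
         (\<chi> i j. rat_of_int (M $ i $ j)) =
           mat2 (u + of_int b * v) (2 * of_int c * v) (- 2 * of_int a * v) (u - of_int b * v) \<and>
         to_PSL2Z M \<in> carrier (Gamma0 p) \<and>
         to_PSL2Z M \<notin> generate (Gamma0 p) (farey_matrices p fa fb s))"
proof (rule allI, rule impI, rule exI[of _ 1], rule conjI[OF zero_less_one], (rule allI)+, (rule impI)+)
  fix \<epsilon> :: real and p :: nat and fa fb s and K :: "real set" and P1 P2 :: "real set" and u v :: rat
    and a b c :: int
  assume \<epsilon>: "0 < \<epsilon>" and p: "prime p" "[int p = - 1] (mod 12)" and fs: "farey_symbol p fa fb s"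
    and K: "real_quadratic_field K" "class_number K = 1"
    and "splits_as K p P1 P2"
    and "\<not> (\<exists>x\<in>carrier (ring_of_integers K). P1 = cgenideal (ring_of_integers K) x \<and> field_norm K x > 0)"
    and pell: "minimal_pell_solution (field_discriminant K) u v"
    and disc: "b\<^sup>2 - 4 * a * c = field_discriminant K" and pa: "int p dvd a"
    and large: "1 * real p powr (24 + \<epsilon>) \<le> real_of_int (field_discriminant K)"
  interpret F: farey_pairing "(p + 1) div 3" fa fb p s
    using farey_symbol_pairing p fs by blast
  obtain D r where "quadratic_order D r K" using real_quadratic_field_order[OF K(1)] .
  then interpret O: quadratic_order D r K .
  have D: "field_discriminant K = D" by (rule O.field_discriminant)
  interpret Q: quadratic_form D r K a b c by unfold_locales (use disc D in simp)
  have p2: "2 \<le> p" using p prime_ge_2_nat by blast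
  have "real p powr 2 < real p powr (24 + \<epsilon>)" using p2 \<epsilon> by (intro powr_less_mono) auto
  then have "of_int (int p ^ 2) < (of_int D :: real)" using large p2 by (simp add: D)
  then have pD: "int p ^ 2 < D" by (simp only: of_int_less_iff)
  obtain x y where xy: "a * x\<^sup>2 + b * x * y + c * y\<^sup>2 = 1 \<or> a * x\<^sup>2 + b * x * y + c * y\<^sup>2 = - 1"
    using Q.class_number_one_represents_unit[OF K(2)] .
  obtain w w' where w: "int p dvd snd w" "wedge w w' = 1"
    "(a * (fst w)\<^sup>2 + b * fst w * snd w + c * (snd w)\<^sup>2) *
     (a * (fst w')\<^sup>2 + b * fst w' * snd w' + c * (snd w')\<^sup>2) < 0"
    by (rule Q.crossing_edge[OF refl xy pa _ pD]) (use p2 in simp)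
  have uv: "2 * u \<in> \<int>" "2 * v \<in> \<int>" "0 < v" "u\<^sup>2 - of_int D * v\<^sup>2 = 1"
    using pell by (auto simp: minimal_pell_solution_def positive_pell_solution_def half_integer_def D)
  obtain U V where UV: "2 * u = of_int U" "2 * v = of_int V" using uv by (auto elim!: Ints_cases)
  have "of_int (U\<^sup>2 - D * V\<^sup>2) = (2 * u)\<^sup>2 - of_int D * (2 * v)\<^sup>2" unfolding UV by simp
  also have "\<dots> = of_int 4" using uv(4) by (simp add: power_mult_distrib algebra_simps)
  finally have pellUV: "U\<^sup>2 - D * V\<^sup>2 = 4" by (simp only: of_int_eq_iff)
  have "even (U + b * V)"
  proof -
    have "U\<^sup>2 - (b * V)\<^sup>2 = 2 * (2 - 2 * (a * c * V\<^sup>2))"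
      using pellUV Q.disc by (simp add: algebra_simps power_mult_distrib flip: Q.disc)
    then have "even (U\<^sup>2 - (b * V)\<^sup>2)" by (metis dvd_triv_left)
    then show ?thesis by simp
  qed
  then obtain k where k: "U + b * V = 2 * k" by blast
  define M :: "int^2^2" where "M = mat2 k (c * V) (- a * V) (k - b * V)"
  have "4 * det M = U\<^sup>2 - D * V\<^sup>2"
  proof -
    have U: "U = 2 * k - b * V" using k by simp
    show ?thesis unfolding U M_def Q.disc[symmetric]
      by (simp add: det_2 algebra_simps power2_eq_square)
  qed
  then have det: "det M = 1" using pellUV by simp
  have "(\<chi> i j. rat_of_int (M $ i $ j)) =
      mat2 (u + of_int b * v) (2 * of_int c * v) (- 2 * of_int a * v) (u - of_int b * v)"
  proof -
    have u: "u = of_int U / 2" and v: "v = of_int V / 2" using UV by auto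
    have U: "U = 2 * k - b * V" using k by simp
    show ?thesis unfolding mat2_eq_iff by (simp add: M_def u v U field_simps)
  qed
  moreover have "to_PSL2Z M \<in> carrier (Gamma0 p)"
    using det pa by (auto simp: Gamma0_def M_def)
  moreover have "to_PSL2Z M \<notin> generate (Gamma0 p) (farey_matrices p fa fb s)"
  proof
    assume "to_PSL2Z M \<in> generate (Gamma0 p) (farey_matrices p fa fb s)"
    then obtain A where A: "A \<in> F.words" "{M, - M} = {A, - A}"
      using F.generate_farey_matrices by (fastforce simp: to_PSL2Z)
    then have MW: "M \<in> F.words" using F.words_uminus by (auto simp: doubleton_eq_iff)
    have a0: "a \<noteq> 0" by (rule Q.leading_coeff_nonzero)
    have "V \<noteq> 0" using uv(3) UV by auto
    then have "M $ 2 $ 1 \<noteq> 0" using a0 by (simp add: M_def)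
    then have M1: "M \<noteq> mat 1" "M \<noteq> - mat 1" by auto
    have r2: "r * r = of_int D" "- r * - r = of_int D" using O.s_sq by simp_all
    have "0 \<le> wedge (Q.root_vec r) (int_vec w) * wedge (Q.root_vec (- r)) (int_vec w) *
       (wedge (Q.root_vec r) (int_vec w') * wedge (Q.root_vec (- r)) (int_vec w'))"
      by (rule F.axis_not_crossing[OF MW M1 Q.automorph_eigenvector[OF M_def r2(1)]
            Q.automorph_eigenvector[OF M_def r2(2)] Q.root_irrational Q.root_irrational w(1,2)]) auto
    also have "\<dots> = of_int (16 * (a * a) * ((a * (fst w)\<^sup>2 + b * fst w * snd w + c * (snd w)\<^sup>2) *
        (a * (fst w')\<^sup>2 + b * fst w' * snd w' + c * (snd w')\<^sup>2)))"
      unfolding Q.wedge_roots by simp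
    finally have "0 \<le> 16 * (a * a) * ((a * (fst w)\<^sup>2 + b * fst w * snd w + c * (snd w)\<^sup>2) *
        (a * (fst w')\<^sup>2 + b * fst w' * snd w' + c * (snd w')\<^sup>2))" by (simp only: of_int_0_le_iff)
    moreover have "0 < 16 * (a * a)" using a0 by (simp add: zero_less_mult_iff) linarith
    ultimately show False using w(3) by (meson mult_pos_neg not_le)
  qed
  ultimately show "\<exists>M::int^2^2.
         (\<chi> i j. rat_of_int (M $ i $ j)) =
           mat2 (u + of_int b * v) (2 * of_int c * v) (- 2 * of_int a * v) (u - of_int b * v) \<and>
         to_PSL2Z M \<in> carrier (Gamma0 p) \<and>
         to_PSL2Z M \<notin> generate (Gamma0 p) (farey_matrices p fa fb s)" by blast
qed

end
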